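(* We have \[\lim_{\alpha\to2+0}\dim_{\rm H}\Big(G(\alpha)\cap\{x\in\mathbb R\setminus\mathbb Q:(b_n(x))_{n=1}^\infty\text{ is bounded}\}\Big)=1.\]
   Context: For $x\in\mathbb R$, the irrationality exponent $\mu(x)$ is the supremum of the set of $\mu\in\mathbb R$ such that $|x-p/q|<q^{-\mu}$ holds for infinitely many $(p,q)\in\mathbb Z\times\mathbb N$ with $|p|$ and $q$ coprime. For $\alpha>2$, $G(\alpha)=\{x\in\mathbb R\setminus\mathbb Q:\mu(x)\geq\alpha\}$. Every irrational $x$ has a unique backward continued fraction (BCF) expansion $x=b_0(x)-\cfrac{1}{b_1(x)-\cfrac{1}{b_2(x)-\cdots}}$ with $b_0(x)=\lfloor x\rfloor+1$ and integers $b_n(x)\geq2$ for $n\geq1$. $\dim_{\rm H}$ denotes Hausdorff dimension. *)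

theory Defs
  imports "HOL-Analysis.Analysis"
begin

text \<open>Contribution (diam U)^s of a covering set, with the standard conventions
  diam(empty)^s = 0 and 0^0 = 1.\<close>
definition diam_pow :: "real \<Rightarrow> 'a::metric_space set \<Rightarrow> real" where
  "diam_pow s U = (if U = {} then 0 else if s = 0 then 1 else diameter U powr s)"

definition hausdorff_pre :: "real \<Rightarrow> real \<Rightarrow> 'a::metric_space set \<Rightarrow> ennreal" where
  "hausdorff_pre s \<delta> A =
     (INF U \<in> {U :: nat \<Rightarrow> 'a set. A \<subseteq> (\<Union>i. U i) \<and> (\<forall>i. bounded (U i) \<and> diameter (U i) \<le> \<delta>)}.
        \<Sum>i. ennreal (diam_pow s (U i)))"

definition hausdorff_measure :: "real \<Rightarrow> 'a::metric_space set \<Rightarrow> ennreal" where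
  "hausdorff_measure s A = (SUP \<delta> \<in> {0<..}. hausdorff_pre s \<delta> A)"

definition hausdorff_dim :: "'a::metric_space set \<Rightarrow> real" where
  "hausdorff_dim A = Inf {s. 0 \<le> s \<and> hausdorff_measure s A = 0}"

definition irrationality_exponent :: "real \<Rightarrow> ereal" where
  "irrationality_exponent x =
     Sup {ereal \<mu> | \<mu>. infinite {(p, q). (q::nat) > 0 \<and> coprime \<bar>p::int\<bar> (int q) \<and>
                              \<bar>x - of_int p / of_nat q\<bar> < of_nat q powr (- \<mu>)}}"

definition G :: "real \<Rightarrow> real set" where
  "G \<alpha> = {x. x \<notin> \<rat> \<and> irrationality_exponent x \<ge> ereal \<alpha>}"

text \<open>x_0 = x, x_{n+1} = 1/(b_n - x_n) with b_n = floor(x_n)+1, so that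
  x_n = b_n - 1/x_{n+1}.\<close>
fun bcf_rem :: "nat \<Rightarrow> real \<Rightarrow> real" where
  "bcf_rem 0 x = x"
| "bcf_rem (Suc n) x = 1 / (of_int \<lfloor>bcf_rem n x\<rfloor> + 1 - bcf_rem n x)"

definition bcf_digit :: "nat \<Rightarrow> real \<Rightarrow> int" where
  "bcf_digit n x = \<lfloor>bcf_rem n x\<rfloor> + 1"

end

theory Submission
  imports Defs
begin

text \<open>
  The convergents of the backward continued fraction of x approach x from above only, so its digits
  are bounded as soon as p/q - x is at least c/q^2 for every rational p/q > x; rationals below x may be
  arbitrarily close. Points with this property form a Cantor set. An interval of length R^-l that
  avoids the rationals with small denominator contains R/2 separated intervals of length R^-(l+1), at
  most one of which comes near a rational of the next generation. At very sparse levels k one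
  descends instead, in one step, to an interval of length R^-j at distance R^-j to the right of a
  rational with denominator about R^(k/2), where j = k + 8^i and k is roughly M 8^i; this forces
  irrationality exponent at least 2 + 1/(M+2). The inverse of the coding of the Cantor set by base-m
  expansions, where R = 2m + 2, is Hoelder continuous with an exponent that tends to 1 as m and M grow.
\<close>

section \<open>Intervals that avoid rationals of small denominator\<close>

text \<open>No x in [a, a + R^-l] is close to a rational p/q with 4Rq^2 < R^l. The approximations
  from below made on purpose are only required to be farther than R^-e from x.\<close>
definition good :: "real \<Rightarrow> nat \<Rightarrow> nat \<Rightarrow> real \<Rightarrow> bool" where
  "good R l e a \<longleftrightarrow> (\<forall>(p::int) (q::nat). q > 0 \<and> 4 * R * (real q)\<^sup>2 < R ^ l \<longrightarrow>
     a + 1 / R ^ l + 1 / (8 * R\<^sup>2 * (real q)\<^sup>2) \<le> of_int p / real q \<or>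
     of_int p / real q + min (1 / (8 * R\<^sup>2 * (real q)\<^sup>2)) (1 / R ^ e) \<le> a)"

lemma rational_gap:
  fixes p p' :: int and q q' :: nat
  assumes "q > 0" "q' > 0" "of_int p / real q < of_int p' / real q'"
  shows "1 / (real q * real q') \<le> of_int p' / real q' - of_int p / real q"
proof -
  have "of_int (p * int q') < (of_int (p' * int q) :: real)"
    using assms by (simp add: field_simps)
  then have "p * int q' + 1 \<le> p' * int q"
    unfolding of_int_less_iff by linarith
  then have "of_int (p * int q' + 1) \<le> (of_int (p' * int q) :: real)"
    using of_int_le_iff by blast
  then show ?thesis
    using assms by (simp add: field_simps)
qed

lemma good_0:
  assumes "R \<ge> 1"
  shows "good R 0 e a"
proof -
  have "\<not> 4 * R * (real q)\<^sup>2 < R ^ 0" if "q > 0" for q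
  proof -
    have "1 \<le> R * (real q)\<^sup>2"
      using assms that by (metis One_nat_def Suc_leI mult_mono' mult_1 one_le_power of_nat_1 of_nat_le_iff zero_le_one)
    then show ?thesis by simp
  qed
  then show ?thesis unfolding good_def by blast
qed

text \<open>Rationals with \<open>4 * R * q^2 < R ^ l\<close> are already kept away by the parent
  interval, so an obstruction has \<open>R ^ l \<le> 4 * R * q^2\<close>. For such \<open>q\<close>
  the forbidden margin is at most half the length of the child.\<close>

lemma not_good_imp_near_rational:
  fixes R a :: real
  assumes R: "R \<ge> 1" and good: "good R l e a"
    and c: "a \<le> c" "c + 1 / R ^ Suc l \<le> a + 1 / R ^ l"
    and bad: "\<not> good R (Suc l) e c"
  obtains p :: int and q :: nat where "q > 0" "4 * R * (real q)\<^sup>2 < R ^ Suc l"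
    "c - 1 / R ^ Suc l / 2 < of_int p / real q"
    "of_int p / real q < c + 3 * (1 / R ^ Suc l) / 2"
proof -
  obtain p :: int and q :: nat where q: "q > 0" "4 * R * (real q)\<^sup>2 < R ^ Suc l"
    and 1: "of_int p / real q < c + 1 / R ^ Suc l + 1 / (8 * R\<^sup>2 * (real q)\<^sup>2)"
    and 2: "c < of_int p / real q + min (1 / (8 * R\<^sup>2 * (real q)\<^sup>2)) (1 / R ^ e)"
    using bad unfolding good_def by (auto simp: not_le)
  have ge: "R ^ l \<le> 4 * R * (real q)\<^sup>2"
  proof (rule ccontr)
    assume "\<not> ?thesis"
    then have "a + 1 / R ^ l + 1 / (8 * R\<^sup>2 * (real q)\<^sup>2) \<le> of_int p / real q \<or>
     of_int p / real q + min (1 / (8 * R\<^sup>2 * (real q)\<^sup>2)) (1 / R ^ e) \<le> a"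
      using good q(1) unfolding good_def by (auto simp: not_le)
    then show False using 1 2 c by linarith
  qed
  have "2 * R ^ Suc l \<le> 8 * R\<^sup>2 * (real q)\<^sup>2"
    using mult_left_mono[OF ge, of "2 * R"] R by (simp add: power2_eq_square algebra_simps)
  then have "1 / (8 * R\<^sup>2 * (real q)\<^sup>2) \<le> 1 / (2 * R ^ Suc l)"
    using R by (intro divide_left_mono mult_pos_pos) (auto simp: q)
  also have "\<dots> = 1 / R ^ Suc l / 2" by simp
  finally have 3: "1 / (8 * R\<^sup>2 * (real q)\<^sup>2) \<le> 1 / R ^ Suc l / 2" .
  define h z where "h = 1 / R ^ Suc l" and "z = 1 / (8 * R\<^sup>2 * (real q)\<^sup>2)"
  have "c - h / 2 < of_int p / real q" "of_int p / real q < c + 3 * h / 2"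
    using 1 2 3 unfolding h_def[symmetric] z_def[symmetric] by linarith+
  with that q show ?thesis unfolding h_def by blast
qed

text \<open>Two bad children would yield two distinct rationals less than \<open>1 / R ^ l\<close>
  apart. Both squared denominators are below \<open>R ^ l / 4\<close>, which forces a gap greater
  than \<open>4 / R ^ l\<close>.\<close>

lemma at_most_one_bad_child:
  fixes R a :: real and m :: nat
  assumes R: "R = 2 * real m + 2" and good: "good R l e a"
  shows "\<exists>b. \<forall>i\<le>m. i \<noteq> b \<longrightarrow> good R (Suc l) e (a + 2 * real i / R ^ Suc l)"
proof (rule ccontr)
  define h where "h = 1 / R ^ Suc l"
  have hp: "h > 0" and hR: "R * h = 1 / R ^ l" using R by (auto simp: h_def)
  define c where "c i = a + 2 * real i / R ^ Suc l" for i :: nat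
  have c: "c i = a + 2 * real i * h" for i by (simp add: c_def h_def)
  assume "\<not> ?thesis"
  then have ex: "\<exists>i\<le>m. i \<noteq> b \<and> \<not> good R (Suc l) e (c i)" for b
    by (auto simp: c_def)
  obtain i where i: "i \<le> m" "\<not> good R (Suc l) e (c i)" using ex by blast
  obtain i' where i': "i' \<le> m" "i' \<noteq> i" "\<not> good R (Suc l) e (c i')" using ex by blast
  have "\<exists>u v. u \<le> m \<and> v \<le> m \<and> u < v \<and> \<not> good R (Suc l) e (c u) \<and> \<not> good R (Suc l) e (c v)"
    using i i' by (metis nat_neq_iff)
  then obtain u v where uv: "u \<le> m" "v \<le> m" "u < v"
    "\<not> good R (Suc l) e (c u)" "\<not> good R (Suc l) e (c v)" by blast
  have inside: "a \<le> c w" "c w + 1 / R ^ Suc l \<le> a + 1 / R ^ l" if "w \<le> m" for w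
  proof -
    show "a \<le> c w" using hp by (simp add: c)
    have "(2 * real w + 1) * h \<le> R * h" using that hp R by (intro mult_right_mono) auto
    then show "c w + 1 / R ^ Suc l \<le> a + 1 / R ^ l"
      unfolding c h_def[symmetric] hR by (simp add: algebra_simps)
  qed
  have R1: "R \<ge> 1" using R by simp
  obtain p :: int and q :: nat where pq: "q > 0" "4 * R * (real q)\<^sup>2 < R ^ Suc l"
    "c u - h / 2 < of_int p / real q" "of_int p / real q < c u + 3 * h / 2"
    using not_good_imp_near_rational[OF R1 good inside[OF uv(1)] uv(4)] unfolding h_def by metis
  obtain p' :: int and q' :: nat where pq': "q' > 0" "4 * R * (real q')\<^sup>2 < R ^ Suc l"
    "c v - h / 2 < of_int p' / real q'" "of_int p' / real q' < c v + 3 * h / 2"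
    using not_good_imp_near_rational[OF R1 good inside[OF uv(2)] uv(5)] unfolding h_def by metis
  have "(real u + 1) * h \<le> real v * h" using uv hp by (intro mult_right_mono) auto
  then have "c u + 2 * h \<le> c v" by (simp add: c algebra_simps)
  \<comment> \<open>The spacing of two lengths makes the enlarged children, from
    \<open>c - h / 2\<close> to \<open>c + 3 * h / 2\<close>, disjoint, so the two rationals
    differ.\<close>
  then have lt: "of_int p / real q < of_int p' / real q'" using pq(4) pq'(3) by linarith
  have "(real v - real u) * h \<le> real m * h" using uv hp by (intro mult_right_mono) auto
  \<comment> \<open>The outermost enlarged children together span at most
    \<open>(2 * m + 2) * h\<close>; this is the origin of \<open>R = 2 * m + 2\<close>.\<close>
  then have "c v - c u + 2 * h \<le> R * h" by (simp add: c R algebra_simps)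
  then have le: "of_int p' / real q' - of_int p / real q < 1 / R ^ l"
    using pq(3) pq'(4) hR by linarith
  have "1 / (real q * real q') < 1 / R ^ l"
    using rational_gap[OF pq(1) pq'(1) lt] le by linarith
  then have "R ^ l < real q * real q'"
    using pq(1) pq'(1) R1 by (simp add: field_simps)
  moreover have "real q * real q' \<le> ((real q)\<^sup>2 + (real q')\<^sup>2) / 2"
    using sum_squares_bound[of "real q" "real q'"] by simp
  ultimately have "R * R ^ l < R * (((real q)\<^sup>2 + (real q')\<^sup>2) / 2)"
    using R1 by (intro mult_strict_left_mono) auto
  moreover have "8 * (R * (((real q)\<^sup>2 + (real q')\<^sup>2) / 2)) < 2 * (R * R ^ l)"
    using pq(2) pq'(2) by (simp add: algebra_simps)
  moreover have "R * R ^ l > 0" using R1 by simp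
  ultimately show False by linarith
qed

section \<open>Descent from a good interval to a nearby rational\<close>

text \<open>Dirichlet's theorem at the midpoint gives \<open>p / q\<close> with error below
  \<open>1 / (q * N)\<close>. Goodness excludes small \<open>q\<close>, and once
  \<open>X \<le> 4 * R * q^2\<close> the error is at most a quarter of the length, so
  \<open>p / q\<close> falls in the middle half of the interval. The condition
  \<open>2 * e \<le> k\<close> stops the weaker left margin \<open>1 / R ^ e\<close> from admitting
  small \<open>q\<close>.\<close>

lemma rational_near_good:
  fixes R a :: real
  assumes R: "R \<ge> 100" and good: "good R k e a" and e: "2 * e \<le> k"
  obtains p :: int and q :: nat where "q > 0" "real q \<le> 9 * R * sqrt (R ^ k)"
    "a + 1 / (4 * R ^ k) \<le> of_int p / real q" "of_int p / real q \<le> a + 3 / (4 * R ^ k)"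
proof -
  define X where "X = R ^ k"
  define K where "K = sqrt X"
  have X1: "X \<ge> 1" unfolding X_def using R by simp
  have K1: "K \<ge> 1" and KK: "K * K = X" unfolding K_def using X1 by auto
  \<comment> \<open>The estimates use \<open>8 * R * K \<le> N\<close>; the factor 9 leaves room for
    rounding.\<close>
  define N where "N = nat \<lfloor>9 * R * K\<rfloor>"
  have RK: "R * K \<ge> 1" using R K1 by (metis mult_mono' mult_1 order_trans zero_le_one one_le_numeral)
  have N1: "real N \<le> 9 * R * K" 
  proof -
    have "0 \<le> 9 * R * K" using RK by linarith
    then show ?thesis unfolding N_def by simp
  qed
  have N2: "8 * R * K \<le> real N" unfolding N_def using RK by linarith
  have N0: "N > 0" 
  proof -
    have "real N > 0" using N2 RK by linarith
    then show ?thesis by simp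
  qed
  define y where "y = a + 1 / (2 * X)"
  obtain q0 p :: int where q0: "0 < q0" "q0 \<le> int N"
    and p0: "\<bar>of_int q0 * y - of_int p\<bar> < 1 / real N"
  proof (rule Dirichlet_approx_simult[OF N0, of 1 "\<lambda>_. y"])
    fix q :: int and p :: "nat \<Rightarrow> int"
    assume "0 < q" "q \<le> int (N ^ 1)" "\<And>i. i < 1 \<Longrightarrow> \<bar>of_int q * y - of_int (p i)\<bar> < 1 / real N"
    then show thesis using that[of q "p 0"] by simp
  qed
  define q where "q = nat q0"
  have q: "q > 0" "q \<le> N" and qq: "real q = of_int q0" using q0 by (auto simp: q_def)
  have ap: "\<bar>real q * y - of_int p\<bar> < 1 / real N" using p0 by (simp add: qq)
  have "y - of_int p / real q = (real q * y - of_int p) / real q"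
    using q by (simp add: field_simps)
  then have "\<bar>y - of_int p / real q\<bar> = \<bar>real q * y - of_int p\<bar> / real q" by simp
  also have "\<dots> < 1 / real N / real q" using ap q by (intro divide_strict_right_mono) auto
  finally have d: "\<bar>y - of_int p / real q\<bar> < 1 / (real q * real N)" by (simp add: mult.commute)
  have NN: "64 * R\<^sup>2 * X \<le> (real N)\<^sup>2"
    using power_mono[OF N2, of 2] R K1 by (simp add: power_mult_distrib power2_eq_square KK algebra_simps flip: KK)
  have qp: "real q > 0" "real N > 0" "real q \<ge> 1" using q N0 by auto
  have big: "X \<le> 4 * R * (real q)\<^sup>2"
  proof (rule ccontr)
    assume "\<not> ?thesis"
    then have lt: "q > 0 \<and> 4 * R * (real q)\<^sup>2 < R ^ k" using q by (auto simp: X_def)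
    define z w h v where "z = 1 / (8 * R\<^sup>2 * (real q)\<^sup>2)" "w = 1 / R ^ e" "h = 1 / (2 * X)"
      "v = of_int p / real q"
    note defs = this
    have 1: "a + 1 / X + z \<le> v \<or> v + min z w \<le> a"
      using good lt unfolding good_def X_def defs by blast
    have 2: "z > 0" "w > 0" "h > 0" using R q X1 by (auto simp: defs)
    have 3: "1 / X = h + h" by (simp add: defs field_simps)
    \<comment> \<open>A rational outside the interval, on either side, is at least half a length and
      at least the smaller margin away from the midpoint.\<close>
    from 1 have "min z w \<le> \<bar>a + h - v\<bar> \<and> h \<le> \<bar>a + h - v\<bar>"
    proof
      assume "a + 1 / X + z \<le> v"
      then show ?thesis using 2 3 by linarith
    next
      assume "v + min z w \<le> a"
      then show ?thesis using 2 3 by linarith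
    qed
    then have "min (1 / (8 * R\<^sup>2 * (real q)\<^sup>2)) (1 / R ^ e) \<le> \<bar>y - of_int p / real q\<bar>"
      and "1 / (2 * X) \<le> \<bar>y - of_int p / real q\<bar>" unfolding y_def defs by blast+
    then have "min (1 / (8 * R\<^sup>2 * (real q)\<^sup>2)) (1 / R ^ e) < 1 / (real q * real N)"
      and "1 / (2 * X) < 1 / (real q * real N)" using d by linarith+
    then have qN: "real q * real N < 2 * X"
      and alt: "1 / (8 * R\<^sup>2 * (real q)\<^sup>2) < 1 / (real q * real N) \<or> 1 / R ^ e < 1 / (real q * real N)"
      using X1 qp by (auto simp: field_simps min_def split: if_splits)
    \<comment> \<open>The first case would give \<open>N^2 < 16 * R^2 * X\<close>, the second
      \<open>N < R ^ e \<le> K\<close>; both contradict \<open>N \<ge> 8 * R * K\<close>.\<close>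
    from alt show False
    proof
      assume "1 / (8 * R\<^sup>2 * (real q)\<^sup>2) < 1 / (real q * real N)"
      then have "real q * real N < 8 * R\<^sup>2 * (real q)\<^sup>2"
        using qp R by (subst (asm) divide_less_eq) (auto simp: field_simps)
      then have "real q * real N < real q * (8 * R\<^sup>2 * real q)"
        by (simp add: power2_eq_square algebra_simps)
      then have "real N < 8 * R\<^sup>2 * real q" using qp by simp
      then have "real N * real N < 8 * R\<^sup>2 * real q * real N" using qp by simp
      also have "\<dots> = 8 * R\<^sup>2 * (real q * real N)" by simp
      also have "\<dots> < 8 * R\<^sup>2 * (2 * X)" using qN R by (intro mult_strict_left_mono) auto
      also have "\<dots> \<le> 64 * R\<^sup>2 * X" using R X1 by simp
      finally show False using NN by (simp add: power2_eq_square)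
    next
      assume "1 / R ^ e < 1 / (real q * real N)"
      then have "real q * real N < R ^ e" using qp R by (simp add: field_simps)
      moreover have "R ^ e \<le> K"
      proof -
        have "(R ^ e)\<^sup>2 \<le> X" unfolding X_def using e R
          by (subst power_mult[symmetric], intro power_increasing) auto
        then show ?thesis unfolding K_def using real_le_rsqrt by blast
      qed
      moreover have "1 * real N \<le> real q * real N" using qp by (intro mult_right_mono) auto
      moreover have "1 * K \<le> (8 * R) * K" using R K1 by (intro mult_right_mono) auto
      ultimately show False using N2 by linarith
    qed
  qed
  have "(4 * X)\<^sup>2 \<le> (real q * real N)\<^sup>2"
  proof -
    have "(4 * X)\<^sup>2 \<le> 16 * R * X\<^sup>2" using R mult_right_mono[of 1 R "X\<^sup>2"] by (simp add: power_mult_distrib)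
    also have "\<dots> = X / (4 * R) * (64 * R\<^sup>2 * X)" using R by (simp add: power2_eq_square field_simps)
    also have "\<dots> \<le> (real q)\<^sup>2 * (real N)\<^sup>2"
      using big NN R X1 by (intro mult_mono) (auto simp: field_simps)
    finally show ?thesis by (simp add: power_mult_distrib)
  qed
  then have "4 * X \<le> real q * real N" by (rule power2_le_imp_le) simp
  then have "1 / (real q * real N) \<le> 1 / (4 * X)" using X1 qp by (intro divide_left_mono) auto
  then have d': "\<bar>y - of_int p / real q\<bar> \<le> 1 / (4 * X)" using d by linarith
  have "1 / (2 * X) = 1 / (4 * X) + 1 / (4 * X)" "3 / (4 * X) = 1 / (4 * X) + 1 / (4 * X) + 1 / (4 * X)"
    by (simp_all add: field_simps)
  then have "a + 1 / (4 * X) \<le> of_int p / real q" "of_int p / real q \<le> a + 3 / (4 * X)"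
    using d' unfolding y_def by linarith+
  moreover have "real q \<le> 9 * R * sqrt (R ^ k)"
    using q(2) N1 by (simp add: K_def X_def)
  ultimately show ?thesis using that[of q p] q(1) by (simp add: X_def)
qed

text \<open>The new interval starts \<open>1 / R ^ j\<close> to the right of \<open>p / q\<close>,
  and the choice \<open>e = j\<close> tolerates every rational up to \<open>p / q\<close>. A
  rational \<open>p' / q'\<close> beyond \<open>p / q\<close> is kept away by the parent if
  \<open>q'\<close> is small; otherwise its distance from \<open>p / q\<close>, at least
  \<open>1 / (q * q')\<close>, covers the new interval and the margin.\<close>

lemma good_near_rational:
  fixes R a :: real
  assumes R: "R \<ge> 100" and good: "good R k e a" and e: "2 * e \<le> k" and j: "j \<ge> k + 6"
  obtains p :: int and q :: nat where "q > 0" "real q \<le> 9 * R * sqrt (R ^ k)"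
    "good R j j (of_int p / real q + 1 / R ^ j)"
    "a \<le> of_int p / real q" "of_int p / real q + 2 / R ^ j \<le> a + 1 / R ^ k"
proof -
  define X where "X = R ^ k"
  define Y where "Y = R ^ j"
  have X1: "X \<ge> 1" unfolding X_def using R by simp
  have YX: "R ^ 6 * X \<le> Y" unfolding X_def Y_def power_add[symmetric]
    using R j by (intro power_increasing) auto
  have "8 * X \<le> R ^ 6 * X"
    using R X1 power_mono[of 100 R 6] by (intro mult_right_mono) auto
  then have Y8: "8 * X \<le> Y" using YX by linarith
  obtain p :: int and q :: nat where q: "q > 0" "real q \<le> 9 * R * sqrt (R ^ k)"
    and pq: "a + 1 / (4 * R ^ k) \<le> of_int p / real q" "of_int p / real q \<le> a + 3 / (4 * R ^ k)"
    using rational_near_good[OF R good e] .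
  have "2 / Y \<le> 2 / (8 * X)" using X1 Y8 by (intro divide_left_mono) auto
  then have "2 / Y \<le> 1 / (4 * X)" by simp
  moreover have "1 / X = 3 / (4 * X) + 1 / (4 * X)" "1 / (4 * X) > 0" using X1 by (auto simp: field_simps)
  ultimately have in1: "a < of_int p / real q" and in2: "of_int p / real q + 2 / Y \<le> a + 1 / X"
    using pq unfolding X_def[symmetric] by linarith+
  have q2: "(real q)\<^sup>2 \<le> 81 * R\<^sup>2 * X"
    using power_mono[OF q(2), of 2] X1 by (simp add: power_mult_distrib X_def)
  have "good R j j (of_int p / real q + 1 / R ^ j)"
    unfolding good_def
  proof (intro allI impI)
    fix p' :: int and q' :: nat
    assume "0 < q' \<and> 4 * R * (real q')\<^sup>2 < R ^ j"
    then have q': "q' > 0" "4 * R * (real q')\<^sup>2 < Y" by (auto simp: Y_def)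
    show "of_int p / real q + 1 / R ^ j + 1 / R ^ j + 1 / (8 * R\<^sup>2 * (real q')\<^sup>2) \<le> of_int p' / real q' \<or>
       of_int p' / real q' + min (1 / (8 * R\<^sup>2 * (real q')\<^sup>2)) (1 / R ^ j) \<le> of_int p / real q + 1 / R ^ j"
    proof (cases "of_int p' / real q' \<le> of_int p / real q")
      case True
      then show ?thesis by linarith
    next
      case False
      then have lt: "of_int p / real q < of_int p' / real q'" by simp
      have "of_int p / real q + 2 / Y + 1 / (8 * R\<^sup>2 * (real q')\<^sup>2) \<le> of_int p' / real q'"
      proof (cases "4 * R * (real q')\<^sup>2 < X")
        case True
        then have "a + 1 / X + 1 / (8 * R\<^sup>2 * (real q')\<^sup>2) \<le> of_int p' / real q' \<or>
          of_int p' / real q' + min (1 / (8 * R\<^sup>2 * (real q')\<^sup>2)) (1 / R ^ e) \<le> a"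
          using good q'(1) unfolding good_def by (auto simp: X_def)
        moreover have "0 < min (1 / (8 * R\<^sup>2 * (real q')\<^sup>2)) (1 / R ^ e)" using R q' by auto
        ultimately show ?thesis using lt in1 in2 by linarith
      next
        case False
        define t where "t = 1 / (R\<^sup>2 * (real q')\<^sup>2)"
        have qp: "real q > 0" "real q' > 0" using q q' by auto
        have Yp: "Y > 0" using Y8 X1 by linarith
        have tp: "t > 0" using qp R by (simp add: t_def)
        \<comment> \<open>Here \<open>t / 8\<close> is the margin. If \<open>q \<le> q'\<close>, the
          right side is at least \<open>R^2 * t\<close> and \<open>2 / Y \<le> R * t / 2\<close>.
          Otherwise \<open>q \<le> 5 * R^2 * q'\<close> leaves only \<open>t / 5\<close>, but
          \<open>j \<ge> k + 6\<close> gives \<open>2 / Y \<le> t / 16\<close>, and 1/16 + 1/8 <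
          1/5.\<close>
        have "2 / Y + t / 8 \<le> 1 / (real q * real q')"
        proof (cases "q \<le> q'")
          case True
          have "R\<^sup>2 * t = 1 / (real q' * real q')" using R by (simp add: t_def power2_eq_square)
          also have "\<dots> \<le> 1 / (real q * real q')"
            using True qp by (intro divide_left_mono mult_right_mono) auto
          finally have 1: "R\<^sup>2 * t \<le> 1 / (real q * real q')" .
          have "2 / Y \<le> 2 / (4 * R * (real q')\<^sup>2)"
            using q'(2) Yp qp R by (intro divide_left_mono) auto
          also have "\<dots> = R * t / 2" using R qp by (simp add: t_def power2_eq_square field_simps)
          finally have 2: "2 / Y \<le> R * t / 2" .
          have "100 * (R * t) \<le> R\<^sup>2 * t" "100 * t \<le> R * t"
            using R tp by (auto simp: power2_eq_square)
          then show ?thesis using 1 2 tp by linarith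
        next
          case F: False
          have "(real q)\<^sup>2 \<le> (5 * R\<^sup>2 * real q')\<^sup>2"
          proof -
            have "(real q)\<^sup>2 \<le> 81 * R\<^sup>2 * X" by (rule q2)
            also have "\<dots> \<le> (25 * R / 4) * R\<^sup>2 * X"
              using R X1 by (intro mult_right_mono) auto
            also have "\<dots> = 25 * R ^ 3 / 4 * X" by (simp add: power2_eq_square power3_eq_cube)
            also have "\<dots> \<le> 25 * R ^ 3 / 4 * (4 * R * (real q')\<^sup>2)"
              using False R by (intro mult_left_mono) auto
            also have "\<dots> = (5 * R\<^sup>2 * real q')\<^sup>2"
              by (simp add: power_mult_distrib power2_eq_square power3_eq_cube)
            finally show ?thesis .
          qed
          then have "real q \<le> 5 * R\<^sup>2 * real q'" by (rule power2_le_imp_le) (use R in auto)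
          then have "real q * real q' \<le> 5 * R\<^sup>2 * real q' * real q'" by (intro mult_right_mono) auto
          then have "real q * real q' \<le> 5 * (R\<^sup>2 * (real q')\<^sup>2)" by (simp add: power2_eq_square)
          then have "1 / (5 * (R\<^sup>2 * (real q')\<^sup>2)) \<le> 1 / (real q * real q')"
            using qp R by (intro divide_left_mono) auto
          then have 1: "t / 5 \<le> 1 / (real q * real q')" by (simp add: t_def)
          have "32 * R\<^sup>2 * (real q')\<^sup>2 \<le> 32 * R\<^sup>2 * (real q)\<^sup>2"
            using F R by (intro mult_left_mono power_mono) auto
          also have "\<dots> \<le> 32 * R\<^sup>2 * (81 * R\<^sup>2 * X)"
            using q2 R by (intro mult_left_mono) auto
          also have "\<dots> = 2592 * (R ^ 4 * X)" by (simp add: power2_eq_square power4_eq_xxxx)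
          also have "\<dots> \<le> R\<^sup>2 * (R ^ 4 * X)"
            using R X1 power_mono[of 100 R 2] by (intro mult_right_mono) auto
          also have "\<dots> = R ^ 6 * X" by (simp add: power2_eq_square power4_eq_xxxx eval_nat_numeral)
          also have "\<dots> \<le> Y" by (rule YX)
          finally have "2 / Y \<le> 2 / (32 * R\<^sup>2 * (real q')\<^sup>2)"
            using qp R Yp by (intro divide_left_mono) auto
          also have "\<dots> = t / 16" by (simp add: t_def)
          finally show ?thesis using 1 tp by linarith
        qed
        moreover have "t / 8 = 1 / (8 * R\<^sup>2 * (real q')\<^sup>2)" by (simp add: t_def)
        ultimately show ?thesis using rational_gap[OF q(1) q'(1) lt] by linarith
      qed
      moreover have "2 / Y = 1 / R ^ j + 1 / R ^ j" by (simp add: Y_def)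
      ultimately show ?thesis by linarith
    qed
  qed
  then show ?thesis using that[of q p] q in1 in2 by (simp add: X_def Y_def)
qed

section \<open>Convergents and digits of backward continued fractions\<close>

text \<open>Indices are shifted by one: the convergent b_0 - 1/(b_1 - ... - 1/b_n) has index n + 1.\<close>
fun bcf_num :: "(nat \<Rightarrow> int) \<Rightarrow> nat \<Rightarrow> int" where
  "bcf_num b 0 = 1"
| "bcf_num b (Suc 0) = b 0"
| "bcf_num b (Suc (Suc n)) = b (Suc n) * bcf_num b (Suc n) - bcf_num b n"

fun bcf_den :: "(nat \<Rightarrow> int) \<Rightarrow> nat \<Rightarrow> int" where
  "bcf_den b 0 = 0"
| "bcf_den b (Suc 0) = 1"
| "bcf_den b (Suc (Suc n)) = b (Suc n) * bcf_den b (Suc n) - bcf_den b n"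

text \<open>The determinant is 1 at every index instead of alternating in sign as for regular
  continued fractions. Hence convergents with positive denominators decrease.\<close>

lemma bcf_det: "bcf_num b n * bcf_den b (Suc n) - bcf_num b (Suc n) * bcf_den b n = 1"
  by (induction n) (simp_all add: algebra_simps)

lemma bcf_den_mono:
  assumes "\<And>n. b (Suc n) \<ge> 2"
  shows "0 \<le> bcf_den b n \<and> bcf_den b n < bcf_den b (Suc n)"
proof (induction n)
  case (Suc n)
  then have "2 * bcf_den b (Suc n) \<le> b (Suc n) * bcf_den b (Suc n)"
    using assms by (intro mult_right_mono) auto
  moreover have "bcf_den b (Suc (Suc n)) = b (Suc n) * bcf_den b (Suc n) - bcf_den b n" by simp
  ultimately show ?case using Suc by linarith
qed simp

lemma bcf_rem_irrational:
  assumes "x \<notin> \<rat>"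
  shows "bcf_rem n x \<notin> \<rat>"
proof (induction n)
  case (Suc n)
  show ?case
  proof
    assume "bcf_rem (Suc n) x \<in> \<rat>"
    then have "1 / bcf_rem (Suc n) x \<in> \<rat>" by (intro Rats_divide) auto
    then have "of_int \<lfloor>bcf_rem n x\<rfloor> + 1 - bcf_rem n x \<in> \<rat>" by simp
    moreover have "of_int \<lfloor>bcf_rem n x\<rfloor> + 1 \<in> (\<rat> :: real set)" by (intro Rats_add) auto
    ultimately have "of_int \<lfloor>bcf_rem n x\<rfloor> + 1 - (of_int \<lfloor>bcf_rem n x\<rfloor> + 1 - bcf_rem n x) \<in> \<rat>"
      using Rats_diff by blast
    then show False using Suc by simp
  qed
qed (use assms in simp)

lemma bcf_rem_digit:
  assumes "x \<notin> \<rat>"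
  shows "bcf_rem n x < bcf_digit n x" "bcf_digit n x < bcf_rem n x + 1"
    "bcf_rem n x = bcf_digit n x - 1 / bcf_rem (Suc n) x"
    "bcf_rem (Suc n) x > 1" "bcf_digit (Suc n) x \<ge> 2"
proof -
  have lt: "bcf_rem k x < bcf_digit k x" for k
    unfolding bcf_digit_def by linarith
  have "of_int \<lfloor>bcf_rem n x\<rfloor> \<noteq> bcf_rem n x"
    using bcf_rem_irrational[OF assms] by (metis Rats_of_int)
  then have gt: "bcf_digit n x < bcf_rem n x + 1"
    unfolding bcf_digit_def by (simp add: order_less_le)
  have s: "bcf_rem (Suc n) x = 1 / (bcf_digit n x - bcf_rem n x)"
    by (simp add: bcf_digit_def)
  show "bcf_rem n x < bcf_digit n x" "bcf_digit n x < bcf_rem n x + 1"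
    "bcf_rem n x = bcf_digit n x - 1 / bcf_rem (Suc n) x"
    using lt gt s by auto
  show g: "bcf_rem (Suc n) x > 1" using lt[of n] gt s by simp
  have "1 < real_of_int (bcf_digit (Suc n) x)" using g lt[of "Suc n"] by linarith
  then show "bcf_digit (Suc n) x \<ge> 2" by linarith
qed

text \<open>This is the Moebius map of the convergent matrix, taking the remainder back to
  \<open>x\<close>, with its denominator cleared.\<close>

lemma bcf_moebius:
  assumes "x \<notin> \<rat>"
  defines "b \<equiv> \<lambda>n. bcf_digit n x"
  shows "x * (bcf_den b (Suc n) * bcf_rem (Suc n) x - bcf_den b n)
       = bcf_num b (Suc n) * bcf_rem (Suc n) x - bcf_num b n"
proof (induction n)
  case 0
  have "x = bcf_digit 0 x - 1 / bcf_rem (Suc 0) x" "bcf_rem (Suc 0) x > 1"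
    using bcf_rem_digit(3,4)[OF assms(1), of 0] by simp_all
  then have "x * bcf_rem (Suc 0) x = bcf_digit 0 x * bcf_rem (Suc 0) x - 1"
    by (simp add: field_simps del: bcf_rem.simps)
  then show ?case by (simp add: b_def del: bcf_rem.simps)
next
  case (Suc n)
  define y where "y = bcf_rem (Suc (Suc n)) x"
  have y: "y > 1" and yr: "bcf_rem (Suc n) x = b (Suc n) - 1 / y"
    unfolding y_def b_def using bcf_rem_digit[OF assms(1)] by blast+
  have e: "A * (b (Suc n) - 1 / y) - B = ((b (Suc n) * A - B) * y - A) / y" for A B :: real
    using y by (simp add: field_simps)
  have "x * (((b (Suc n) * bcf_den b (Suc n) - bcf_den b n) * y - bcf_den b (Suc n)) / y)
    = ((b (Suc n) * bcf_num b (Suc n) - bcf_num b n) * y - bcf_num b (Suc n)) / y"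
    using Suc unfolding yr e by simp
  then show ?case using y unfolding y_def[symmetric] by simp
qed

text \<open>The convergent \<open>P' / Q'\<close> exceeds \<open>x\<close> by
  \<open>1 / (Q' * (Q' * y - Q))\<close>, where \<open>y\<close> is the next remainder and
  \<open>Q < Q'\<close>. A gap of at least \<open>c / Q'^2\<close> therefore bounds \<open>y\<close>
  by \<open>1 / c + 1\<close>, and the digit with it.\<close>

lemma bcf_digits_bounded:
  assumes x: "x \<notin> \<rat>" and "c > 0"
    and bad: "\<And>(p::int) (q::nat). q > 0 \<Longrightarrow> x < p / q \<Longrightarrow> c / (real q)\<^sup>2 \<le> p / q - x"
  shows "\<exists>M. \<forall>n\<ge>1. \<bar>bcf_digit n x\<bar> \<le> M"
proof -
  define b where "b = (\<lambda>n. bcf_digit n x)"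
  have b2: "b (Suc n) \<ge> 2" for n using bcf_rem_digit(5)[OF x] by (simp add: b_def)
  have "\<bar>bcf_digit (Suc n) x\<bar> \<le> \<lceil>1 / c\<rceil> + 2" for n
  proof -
    define y where "y = bcf_rem (Suc n) x"
    define P Q P' Q' where "P = bcf_num b n" "Q = bcf_den b n"
      "P' = bcf_num b (Suc n)" "Q' = bcf_den b (Suc n)"
    note defs = this
    have y1: "y > 1" and dy: "bcf_digit (Suc n) x < y + 1"
      unfolding y_def using bcf_rem_digit[OF x] by blast+
    have Q: "0 \<le> Q" "Q < Q'" unfolding defs using bcf_den_mono[of b] b2 by blast+
    have det: "P * Q' - P' * Q = 1" unfolding defs by (rule bcf_det)
    then have det': "real_of_int P * Q' - real_of_int P' * Q = 1"
      by (metis of_int_1 of_int_diff of_int_mult)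
    have moeb: "x * (Q' * y - Q) = P' * y - P"
      unfolding defs y_def b_def by (rule bcf_moebius[OF x])
    define D where "D = Q' * y - Q"
    have "real_of_int Q' * 1 < Q' * y" using y1 Q by (intro mult_strict_left_mono) auto
    moreover have "real_of_int Q < Q'" using Q by simp
    ultimately have D: "D > 0" unfolding D_def by linarith
    have Qp: "real_of_int Q' > 0" using Q by simp
    have "P' / Q' - x = 1 / (Q' * D)"
    proof -
      have xe: "x = (P' * y - P) / D" using moeb D by (simp add: D_def field_simps)
      have "P' * D - Q' * (P' * y - P) = 1" using det' by (simp add: D_def algebra_simps)
      then show ?thesis using D Qp unfolding xe by (simp add: field_simps)
    qed
    moreover from this have "x < P' / Q'" using divide_pos_pos[OF zero_less_one mult_pos_pos[OF Qp D]] by linarith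
    moreover have "real (nat Q') = Q'" using Q by simp
    ultimately have "c / (real_of_int Q')\<^sup>2 \<le> 1 / (Q' * D)"
      using bad[of "nat Q'" P'] Q by simp
    then have "c * D \<le> Q'"
      using D Qp by (simp add: field_simps power2_eq_square)
    then have "D \<le> Q' / c" using \<open>c > 0\<close> by (simp add: field_simps)
    then have "Q' * y \<le> Q' / c + Q'" using \<open>real_of_int Q < Q'\<close> unfolding D_def by linarith
    then have "Q' * y \<le> Q' * (1 / c + 1)" by (simp add: algebra_simps)
    then have "y \<le> 1 / c + 1" using Qp by (simp add: mult_le_cancel_left_pos)
    then have "bcf_digit (Suc n) x \<le> \<lceil>1 / c\<rceil> + 2" using dy by linarith
    moreover have "bcf_digit (Suc n) x \<ge> 2" using b2[of n] by (simp add: b_def)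
    ultimately show ?thesis by linarith
  qed
  then show ?thesis by (metis One_nat_def Suc_le_D)
qed

section \<open>Hausdorff measure and dimension on the real line\<close>

text \<open>A mass distribution argument: the inverse of \<open>f\<close> is Hoelder with exponent
  \<open>s\<close>, so the parameters sent into a set \<open>U\<close> of the cover lie in a ball of
  radius \<open>C * diam_pow s U\<close>. These balls cover the unit interval, so their lengths add
  up to at least 1.\<close>

lemma hausdorff_measure_neq_0:
  fixes f :: "real \<Rightarrow> real" and A :: "real set"
  assumes s: "s \<ge> 0" and C: "C > 0" and img: "f ` {0..<1} \<subseteq> A"
    and hol: "\<And>t u. t \<in> {0..<1} \<Longrightarrow> u \<in> {0..<1} \<Longrightarrow> t \<noteq> u \<Longrightarrow>
      f t \<noteq> f u \<and> \<bar>t - u\<bar> \<le> C * \<bar>f t - f u\<bar> powr s"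
  shows "hausdorff_measure s A \<noteq> 0"
proof -
  have "ennreal (1 / (2 * C)) \<le> hausdorff_pre s 1 A"
    unfolding hausdorff_pre_def
  proof (rule INF_greatest, clarify)
    fix U :: "nat \<Rightarrow> real set"
    assume cov: "A \<subseteq> (\<Union>i. U i)" and U: "\<forall>i. bounded (U i) \<and> diameter (U i) \<le> 1"
    define V where "V i = {t \<in> {0..<1}. f t \<in> U i}" for i
    \<comment> \<open>Closed balls replace the sets \<open>V i\<close>, which need not be
      measurable.\<close>
    define W where "W i = (if V i = {} then {} else
      cball (SOME t. t \<in> V i) (C * diam_pow s (U i)))" for i
    have nn: "diam_pow s (U i) \<ge> 0" for i by (simp add: diam_pow_def)
    have VW: "V i \<subseteq> W i" for i
    proof
      fix u assume u: "u \<in> V i"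
      define t where "t = (SOME t. t \<in> V i)"
      have t: "t \<in> V i" unfolding t_def using u by (rule someI)
      have "\<bar>t - u\<bar> \<le> C * diam_pow s (U i)"
      proof (cases "t = u")
        case True
        then show ?thesis using nn C by simp
      next
        case False
        have tu: "t \<in> {0..<1}" "u \<in> {0..<1}" "f t \<in> U i" "f u \<in> U i"
          using t u by (auto simp: V_def)
        have ne: "f t \<noteq> f u" and le: "\<bar>t - u\<bar> \<le> C * \<bar>f t - f u\<bar> powr s"
          using hol[OF tu(1,2) False] by auto
        have "dist (f t) (f u) \<le> diameter (U i)"
          using tu U by (intro diameter_bounded_bound) auto
        then have "\<bar>f t - f u\<bar> powr s \<le> diameter (U i) powr s"
          using s by (intro powr_mono2) (auto simp: dist_real_def)
        \<comment> \<open>For \<open>s = 0\<close> this may be strict: \<open>0 powr 0 = 0\<close>,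
          whereas \<open>diam_pow\<close> gives a nonempty set the value 1.\<close>
        also have "\<dots> \<le> diam_pow s (U i)" using tu(3) by (auto simp: diam_pow_def powr_def)
        finally show ?thesis using le C by (meson mult_left_mono less_imp_le order_trans)
      qed
      then show "u \<in> W i" using u unfolding W_def t_def[symmetric] by (auto simp: dist_real_def)
    qed
    have Wm: "emeasure lborel (W i) \<le> ennreal (2 * C) * ennreal (diam_pow s (U i))" for i
    proof (cases "V i = {}")
      case False
      have "0 \<le> C * diam_pow s (U i)" using C nn by simp
      then have "emeasure lborel (W i) = ennreal (2 * (C * diam_pow s (U i)))"
        using False by (simp add: W_def cball_eq_atLeastAtMost)
      then show ?thesis using C nn by (simp add: ennreal_mult[symmetric] mult.assoc)
    qed (simp add: W_def)
    have "{0..<1} \<subseteq> (\<Union>i. W i)"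
    proof
      fix t :: real assume t: "t \<in> {0..<1}"
      then obtain i where "f t \<in> U i" using img cov by blast
      then have "t \<in> V i" using t by (simp add: V_def)
      then show "t \<in> (\<Union>i. W i)" using VW by blast
    qed
    then have "emeasure lborel {0..<1::real} \<le> emeasure lborel (\<Union>i. W i)"
      by (intro emeasure_mono) (auto simp: W_def)
    also have "\<dots> \<le> (\<Sum>i. emeasure lborel (W i))"
      by (intro emeasure_subadditive_countably) (auto simp: W_def)
    also have "\<dots> \<le> (\<Sum>i. ennreal (2 * C) * ennreal (diam_pow s (U i)))"
      by (intro suminf_le Wm) auto
    also have "\<dots> = ennreal (2 * C) * (\<Sum>i. ennreal (diam_pow s (U i)))" by simp
    finally have "1 \<le> ennreal (2 * C) * (\<Sum>i. ennreal (diam_pow s (U i)))" by simp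
    then have "ennreal (1 / (2 * C)) * 1 \<le> ennreal (1 / (2 * C)) * (ennreal (2 * C) * (\<Sum>i. ennreal (diam_pow s (U i))))"
      by (intro mult_left_mono) auto
    also have "\<dots> = ennreal (1 / (2 * C) * (2 * C)) * (\<Sum>i. ennreal (diam_pow s (U i)))"
      using C by (subst ennreal_mult) (auto simp: mult.assoc)
    also have "\<dots> = (\<Sum>i. ennreal (diam_pow s (U i)))" using C by simp
    finally show "ennreal (1 / (2 * C)) \<le> (\<Sum>i. ennreal (diam_pow s (U i)))" by simp
  qed
  also have "\<dots> \<le> hausdorff_measure s A"
    unfolding hausdorff_measure_def by (rule SUP_upper) auto
  finally show ?thesis using C by (auto simp: ennreal_eq_0_iff)
qed

text \<open>Intervals of lengths \<open>\<eta> / n\<close> laid end to end from 0 exhaust a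
  half-line, as the harmonic series diverges, while the powers of these lengths with an exponent
  above 1 are summable. Even indices serve the right half-line, odd ones the left.\<close>

lemma interval_cover_real:
  fixes \<eta> :: real
  assumes "\<eta> > 0"
  obtains U :: "nat \<Rightarrow> real set" where "(\<Union>i. U i) = UNIV"
    "\<forall>i. \<exists>a. U i = {a..a + \<eta> / real (Suc (i div 2))}"
proof -
  define S where "S n = \<eta> * (harm n :: real)" for n
  have S_Suc: "S (Suc n) = S n + \<eta> / real (Suc n)" for n
    unfolding S_def harm_Suc divide_inverse by (rule distrib_left)
  have S0: "S 0 = 0" by (simp add: S_def harm_def)
  have cov: "\<exists>n. S n \<le> x \<and> x \<le> S (Suc n)" if "x \<ge> 0" for x
  proof -
    have "filterlim S at_top sequentially"
      unfolding S_def by (rule filterlim_tendsto_pos_mult_at_top[OF tendsto_const assms harm_at_top])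
    then have "eventually (\<lambda>n. x \<le> S n) sequentially" by (simp add: filterlim_at_top)
    then have ex: "\<exists>n. x \<le> S n" by (auto simp: eventually_sequentially)
    define n where "n = (LEAST n. x \<le> S n)"
    have n: "x \<le> S n" unfolding n_def using ex by (rule LeastI_ex)
    show ?thesis
    proof (cases n)
      case 0
      then show ?thesis using n S0 that S_Suc[of 0] assms by (intro exI[of _ 0]) auto
    next
      case (Suc k)
      then have "\<not> x \<le> S k" using not_less_Least[of k "\<lambda>n. x \<le> S n"] by (simp add: n_def)
      then show ?thesis using n Suc by (intro exI[of _ k]) auto
    qed
  qed
  define U where "U i = (if even i then {S (i div 2)..S (Suc (i div 2))}
    else {- S (Suc (i div 2))..- S (i div 2)})" for i
  have "x \<in> (\<Union>i. U i)" for x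
  proof (cases "x \<ge> 0")
    case True
    then obtain n where "S n \<le> x" "x \<le> S (Suc n)" using cov by blast
    then have "x \<in> U (2 * n)" by (simp add: U_def)
    then show ?thesis by blast
  next
    case False
    then obtain n where "S n \<le> - x" "- x \<le> S (Suc n)" using cov[of "- x"] by auto
    then have "x \<in> U (2 * n + 1)" by (auto simp: U_def)
    then show ?thesis by blast
  qed
  moreover have "\<exists>a. U i = {a..a + \<eta> / real (Suc (i div 2))}" for i
  proof (cases "even i")
    case True
    then show ?thesis by (intro exI[of _ "S (i div 2)"]) (simp add: U_def S_Suc)
  next
    case False
    then show ?thesis by (intro exI[of _ "- S (Suc (i div 2))"]) (simp add: U_def S_Suc)
  qed
  ultimately show ?thesis using that[of U] by blast
qed

lemma hausdorff_measure_real_eq_0: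
  fixes A :: "real set"
  assumes s: "s > 1"
  shows "hausdorff_measure s A = 0"
proof -
  have "hausdorff_pre s \<delta> A = 0" if \<delta>: "\<delta> > 0" for \<delta>
  proof -
    define Z where "Z = (\<Sum>i. real (Suc i) powr - s)"
    have "summable (\<lambda>n. real n powr - s)" using s by (simp add: summable_real_powr_iff)
    then have sm: "summable (\<lambda>i. real (Suc i) powr - s)" by (subst summable_Suc_iff)
    have bound: "hausdorff_pre s \<delta> A \<le> ennreal ((2 * \<eta>) powr s * Z)" if \<eta>: "0 < \<eta>" "\<eta> \<le> \<delta>" for \<eta>
    proof -
      obtain U :: "nat \<Rightarrow> real set" where cov: "(\<Union>i. U i) = UNIV"
        and U: "\<forall>i. \<exists>a. U i = {a..a + \<eta> / real (Suc (i div 2))}"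
        by (rule interval_cover_real[OF \<eta>(1)])
      have diam: "bounded (U i) \<and> diameter (U i) = \<eta> / real (Suc (i div 2)) \<and> U i \<noteq> {}" for i
      proof -
        have "\<eta> / real (Suc (i div 2)) \<ge> 0" using \<eta> by simp
        then show ?thesis using spec[OF U, of i] by (auto simp: diameter_closed_interval simp del: of_nat_Suc)
      qed
      have "\<eta> / real (Suc (i div 2)) \<le> \<eta> / 1" for i
        using \<eta> by (intro divide_left_mono) auto
      then have le: "diameter (U i) \<le> \<delta>" for i using diam \<eta> by (metis div_by_1 order_trans)
      have "hausdorff_pre s \<delta> A \<le> (\<Sum>i. ennreal (diam_pow s (U i)))"
        unfolding hausdorff_pre_def using cov diam le by (intro INF_lower) auto
      also have "\<dots> \<le> (\<Sum>i. ennreal ((2 * \<eta>) powr s * real (Suc i) powr - s))"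
      proof (intro suminf_le ennreal_leI)
        fix i
        \<comment> \<open>Each length occurs at two consecutive indices; a factor 2 turns the sum
          into a p-series, and the bound vanishes as \<open>\<eta>\<close> tends to 0.\<close>
        have "Suc i \<le> 2 * Suc (i div 2)" by presburger
        then have "real (Suc i) \<le> 2 * real (Suc (i div 2))" by linarith
        then have "\<eta> / real (Suc (i div 2)) \<le> 2 * \<eta> / real (Suc i)"
          using \<eta> by (simp add: field_simps del: of_nat_Suc)
        then have "(\<eta> / real (Suc (i div 2))) powr s \<le> (2 * \<eta> / real (Suc i)) powr s"
          using \<eta> s by (intro powr_mono2) auto
        also have "\<dots> = (2 * \<eta>) powr s * real (Suc i) powr - s"
          using \<eta> by (simp add: powr_divide powr_minus_divide)
        finally show "diam_pow s (U i) \<le> (2 * \<eta>) powr s * real (Suc i) powr - s"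
          using diam s by (simp add: diam_pow_def)
      qed auto
      also have "\<dots> = ennreal ((2 * \<eta>) powr s * Z)"
        unfolding Z_def using sm by (subst suminf_ennreal2) (auto simp: suminf_mult intro: summable_mult)
      finally show ?thesis .
    qed
    have "((\<lambda>\<eta>. (2 * \<eta>) powr s) \<longlongrightarrow> 0) (at_right 0)"
    proof (rule tendsto_zero_powrI[where b = s])
      show "((\<lambda>\<eta>. 2 * \<eta>) \<longlongrightarrow> 0) (at_right (0::real))" by (auto intro!: tendsto_eq_intros)
      show "eventually (\<lambda>\<eta>. 0 \<le> 2 * \<eta>) (at_right (0::real))" by (intro eventually_at_rightI[of 0 1]) auto
    qed (use s in auto)
    then have lim: "((\<lambda>\<eta>. ennreal ((2 * \<eta>) powr s * Z)) \<longlongrightarrow> ennreal (0 * Z)) (at_right 0)"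
      by (intro tendsto_ennrealI tendsto_mult_right)
    have "hausdorff_pre s \<delta> A \<le> ennreal (0 * Z)"
    proof (rule tendsto_lowerbound[OF lim])
      show "eventually (\<lambda>\<eta>. hausdorff_pre s \<delta> A \<le> ennreal ((2 * \<eta>) powr s * Z)) (at_right 0)"
        using \<delta> by (intro eventually_at_rightI[of 0 \<delta>] bound) auto
    qed simp
    then show ?thesis by simp
  qed
  then show ?thesis unfolding hausdorff_measure_def by (simp add: SUP_eq_const)
qed

lemma hausdorff_dim_le_1: "hausdorff_dim (A :: real set) \<le> 1"
proof (rule field_le_epsilon)
  fix e :: real assume "e > 0"
  then show "hausdorff_dim A \<le> 1 + e"
    unfolding hausdorff_dim_def
    by (intro cInf_lower) (auto simp: hausdorff_measure_real_eq_0 intro: bdd_belowI[of _ 0])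
qed

lemma hausdorff_dim_ge:
  fixes A :: "real set"
  assumes "\<And>s'. 0 \<le> s' \<Longrightarrow> s' < s \<Longrightarrow> hausdorff_measure s' A \<noteq> 0"
  shows "s \<le> hausdorff_dim A"
  unfolding hausdorff_dim_def
proof (rule cInf_greatest)
  \<comment> \<open>The infimum of the empty set of reals is unspecified, so an exponent of measure
    zero must be exhibited.\<close>
  show "{s. 0 \<le> s \<and> hausdorff_measure s A = 0} \<noteq> {}"
    using hausdorff_measure_real_eq_0[of 2 A] by force
qed (use assms in force)

section \<open>Branching, and a criterion for the irrationality exponent\<close>

lemma good_children:
  fixes R a :: real and m :: nat
  assumes R: "R = 2 * real m + 2" and good: "good R l e a"
  shows "\<exists>g. (\<forall>d<m. good R (Suc l) e (g d) \<and> a \<le> g d \<and> g d + 1 / R ^ Suc l \<le> a + 1 / R ^ l) \<and>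
    (\<forall>d<m. \<forall>d'<m. d \<noteq> d' \<longrightarrow> 2 * (1 / R ^ Suc l) \<le> \<bar>g d - g d'\<bar>)"
proof -
  obtain b where b: "\<And>i. i \<le> m \<Longrightarrow> i \<noteq> b \<Longrightarrow> good R (Suc l) e (a + 2 * real i / R ^ Suc l)"
    using at_most_one_bad_child[OF R good] by blast
  \<comment> \<open>The numbering skips the one candidate that may be bad, leaving \<open>m\<close>
    of the \<open>m + 1\<close>.\<close>
  define f where "f d = (if d < b then d else Suc d)" for d
  define h where "h = 1 / R ^ Suc l"
  have hp: "h > 0" and hR: "R * h = 1 / R ^ l" using R by (auto simp: h_def)
  define g where "g d = a + 2 * real (f d) * h" for d
  have f: "f d \<le> m" "f d \<noteq> b" if "d < m" for d using that by (auto simp: f_def)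
  have "good R (Suc l) e (g d) \<and> a \<le> g d \<and> g d + h \<le> a + 1 / R ^ l" if "d < m" for d
  proof (intro conjI)
    show "good R (Suc l) e (g d)" using b[OF f[OF that]] by (simp add: g_def h_def)
    show "a \<le> g d" using hp by (simp add: g_def)
    have "(2 * real (f d) + 1) * h \<le> R * h" using f[OF that] hp R by (intro mult_right_mono) auto
    then show "g d + h \<le> a + 1 / R ^ l" unfolding hR g_def by (simp add: algebra_simps)
  qed
  moreover have "2 * h \<le> \<bar>g d - g d'\<bar>" if "d \<noteq> d'" for d d'
  proof -
    have "f d \<noteq> f d'" using that by (auto simp: f_def split: if_splits)
    then have "1 \<le> \<bar>real (f d) - real (f d')\<bar>" by linarith
    then have "2 * h * 1 \<le> 2 * h * \<bar>real (f d) - real (f d')\<bar>" using hp by (intro mult_left_mono) auto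
    also have "\<dots> = \<bar>2 * h * (real (f d) - real (f d'))\<bar>" using hp by (simp add: abs_mult)
    also have "2 * h * (real (f d) - real (f d')) = g d - g d'" by (simp add: g_def algebra_simps)
    finally show ?thesis by simp
  qed
  ultimately show ?thesis unfolding h_def by blast
qed

text \<open>Finitely many reduced fractions would have a positive least error, as \<open>x\<close>
  is irrational. An approximation with smaller error contradicts this after reduction: cancelling
  does not raise the denominator, so the condition with exponent \<open>\<alpha> \<ge> 0\<close>
  survives.\<close>

lemma irrationality_exponent_ge:
  assumes x: "x \<notin> \<rat>" and "\<alpha> \<ge> 0"
    and approx: "\<And>\<delta>. \<delta> > 0 \<Longrightarrow> \<exists>(p::int) (q::nat). q > 0 \<and> \<bar>x - p / q\<bar> < \<delta> \<and> \<bar>x - p / q\<bar> < real q powr (- \<alpha>)"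
  shows "ereal \<alpha> \<le> irrationality_exponent x"
proof -
  define S where "S = {(p, q). (q::nat) > 0 \<and> coprime \<bar>p::int\<bar> (int q) \<and>
      \<bar>x - of_int p / of_nat q\<bar> < of_nat q powr (- \<alpha>)}"
  have "infinite S"
  proof
    assume fin: "finite S"
    define D where "D = insert 1 ((\<lambda>(p, q). \<bar>x - of_int p / of_nat q\<bar>) ` S)"
    have D: "finite D" "D \<noteq> {}" using fin by (auto simp: D_def)
    have "d > 0" if "d \<in> D" for d
    proof -
      have "x - of_int p / of_nat q \<noteq> 0" for p :: int and q :: nat
      proof
        assume "x - of_int p / of_nat q = 0"
        then have "x = of_int p / of_nat q" by simp
        then show False using x by (metis Rats_divide Rats_of_int Rats_of_nat)
      qed
      then show ?thesis using that by (auto simp: D_def)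
    qed
    then have "Min D > 0" using D by simp
    then obtain p :: int and q :: nat where pq: "q > 0" "\<bar>x - p / q\<bar> < Min D" "\<bar>x - p / q\<bar> < real q powr (- \<alpha>)"
      using approx by blast
    define g where "g = gcd p (int q)"
    define p' where "p' = p div g"
    define q' where "q' = nat (int q div g)"
    have g: "g > 0" using pq(1) by (simp add: g_def)
    have pg: "p = p' * g" and qg: "int q = (int q div g) * g" by (simp_all add: p'_def g_def)
    have dq: "int q div g > 0" using pq(1) g qg by (metis of_nat_0_less_iff zero_less_mult_pos2)
    then have q'e: "int q' = int q div g" by (simp add: q'_def)
    then have qg': "int q = int q' * g" using qg by simp
    have q'0: "q' > 0" using dq q'e by simp
    have cop: "coprime p' (int q')"
      unfolding p'_def q'e g_def using pq(1) by (intro div_gcd_coprime) auto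
    have eq: "real_of_int p / real q = real_of_int p' / real q'"
    proof -
      have "real_of_int p = real_of_int p' * real_of_int g" by (subst pg) simp
      moreover have "real q = real q' * real_of_int g" using qg' by (metis of_int_mult of_int_of_nat_eq)
      ultimately show ?thesis using g by simp
    qed
    have "int q' * 1 \<le> int q' * g" using g by (intro mult_left_mono) auto
    then have "q' \<le> q" using qg' by simp
    then have "real q powr (- \<alpha>) \<le> real q' powr (- \<alpha>)"
      using q'0 \<open>\<alpha> \<ge> 0\<close> by (intro powr_mono2') auto
    then have "(p', q') \<in> S" using pq(3) q'0 cop by (auto simp: S_def eq)
    then have "(\<lambda>(p, q). \<bar>x - of_int p / of_nat q\<bar>) (p', q') \<in> D"
      unfolding D_def by (intro insertI2 imageI)
    then have "Min D \<le> \<bar>x - p' / q'\<bar>" using Min_le[OF D(1)] by simp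
    then show False using pq(2) unfolding eq by linarith
  qed
  then show ?thesis
    unfolding irrationality_exponent_def S_def by (intro Sup_upper) blast
qed

section \<open>Levels of the Cantor construction\<close>

locale cantor_tree =
  fixes m M :: nat
  assumes m: "m \<ge> 49" and M: "M \<ge> 1"
begin

definition R :: real where "R = 2 * real m + 2"

text \<open>Stage n of the construction has intervals of length R^-(level n). At stage M 8^l, where
  l > 0, the descent to a rational uses up 8^l additional levels.\<close>
definition skipped :: "nat \<Rightarrow> nat" where
  "skipped n = (\<Sum>l | 1 \<le> l \<and> M * 8 ^ l < n. 8 ^ l)"

definition level :: "nat \<Rightarrow> nat" where "level n = n + skipped n"

lemma R100: "R \<ge> 100" using m by (simp add: R_def)

lemma finite_skips: "finite {l. 1 \<le> l \<and> M * 8 ^ l < (n::nat)}"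
proof (rule finite_subset)
  show "{l. 1 \<le> l \<and> M * 8 ^ l < n} \<subseteq> {..n}"
  proof clarify
    fix l assume "M * 8 ^ l < n"
    moreover have "l < 8 ^ l" by (induction l) auto
    moreover have "1 * 8 ^ l \<le> M * 8 ^ l" using M by (intro mult_right_mono) auto
    ultimately show "l \<le> n" by linarith
  qed
qed simp

text \<open>The geometric sum is at most 8/7 of its last term \<open>8 ^ k\<close>, and
  \<open>M * 8 ^ k < n\<close>. So the descents use up a share of the levels that is only of order
  1/M.\<close>

lemma skipped_bound: "7 * M * skipped n \<le> 8 * n"
proof -
  let ?S = "{l. 1 \<le> l \<and> M * 8 ^ l < n}"
  show ?thesis
  proof (cases "?S = {}")
    case True
    then show ?thesis by (simp only: skipped_def sum.empty)
  next
    case False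
    define k where "k = Max ?S"
    have k: "k \<in> ?S" unfolding k_def using finite_skips False by (rule Max_in)
    have "?S \<subseteq> {..k}" using finite_skips by (auto simp: k_def)
    then have "skipped n \<le> (\<Sum>l\<le>k. 8 ^ l)" unfolding skipped_def by (intro sum_mono2) auto
    moreover have "7 * (\<Sum>l\<le>k. 8 ^ l) + 1 = (8 * 8 ^ k :: nat)" by (induction k) simp_all
    ultimately have "7 * skipped n \<le> 8 * 8 ^ k" by linarith
    then have "M * (7 * skipped n) \<le> M * (8 * 8 ^ k)" by (rule mult_le_mono2)
    also have "\<dots> = 8 * (M * 8 ^ k)" by simp
    also have "\<dots> \<le> 8 * n" using k by simp
    finally show ?thesis by (simp add: mult.left_commute mult.assoc)
  qed
qed

lemma level_ge: "n \<le> level n" by (simp add: level_def)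

lemma level_le: "M * level n \<le> (M + 2) * n"
  using skipped_bound[of n] by (simp add: level_def algebra_simps)

lemma level_skip_le: "level (M * 8 ^ i) \<le> (M + 2) * 8 ^ i"
proof -
  have "M * level (M * 8 ^ i) \<le> M * ((M + 2) * 8 ^ i)"
    using level_le[of "M * 8 ^ i"] by (simp add: algebra_simps)
  then show ?thesis using M by simp
qed

lemma level_0: "level 0 = 0" by (simp add: level_def skipped_def)

text \<open>The descent by \<open>8 ^ i\<close> levels is followed by one ordinary branching step in
  the same stage, so that this stage too has \<open>m\<close> children.\<close>

lemma level_Suc_skip:
  assumes "i \<ge> 1"
  shows "level (Suc (M * 8 ^ i)) = Suc (level (M * 8 ^ i) + 8 ^ i)"
proof -
  have "{l. 1 \<le> l \<and> M * 8 ^ l < Suc (M * 8 ^ i)} = insert i {l. 1 \<le> l \<and> M * 8 ^ l < M * 8 ^ i}"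
    using M assms by (auto simp: less_Suc_eq)
  then have "skipped (Suc (M * 8 ^ i)) = 8 ^ i + skipped (M * 8 ^ i)"
    unfolding skipped_def using finite_skips[of "M * 8 ^ i"] by simp
  then show ?thesis by (simp add: level_def)
qed

lemma level_Suc:
  assumes "\<And>i. i \<ge> 1 \<Longrightarrow> n \<noteq> M * 8 ^ i"
  shows "level (Suc n) = Suc (level n)"
proof -
  have "{l. 1 \<le> l \<and> M * 8 ^ l < Suc n} = {l. 1 \<le> l \<and> M * 8 ^ l < n}"
    using assms by (auto simp: less_Suc_eq)
  then show ?thesis by (simp add: level_def skipped_def)
qed

section \<open>Nodes of the tree\<close>

definition len :: "nat \<Rightarrow> real" where "len n = 1 / R ^ level n"

lemma len_pos: "len n > 0" using R100 by (simp add: len_def)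

text \<open>In the construction \<open>e\<close> is the level reached by the last descent, or 0
  before the first. The inequality is the hypothesis \<open>2 * e \<le> k\<close> of
  \<open>good_near_rational\<close> for all descents still to come.\<close>

definition admissible :: "nat \<Rightarrow> real \<Rightarrow> bool" where
  "admissible n a \<longleftrightarrow> (\<exists>e. good R (level n) e a \<and> (\<forall>i\<ge>1. n \<le> M * 8 ^ i \<longrightarrow> 2 * e \<le> level (M * 8 ^ i)))"

text \<open>A record of the descent at stage \<open>n\<close>, with \<open>y\<close> the left end of
  an interval of the next stage; it is vacuous at ordinary stages.\<close>

definition near_rational :: "nat \<Rightarrow> real \<Rightarrow> bool" where
  "near_rational n y \<longleftrightarrow> (\<forall>i\<ge>1. n = M * 8 ^ i \<longrightarrow>
     (\<exists>(p::int) (q::nat). q > 0 \<and> real q \<le> 9 * R * sqrt (R ^ level n) \<and>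
        p / q + 1 / R ^ (level n + 8 ^ i) \<le> y \<and> y + len (Suc n) \<le> p / q + 2 / R ^ (level n + 8 ^ i)))"

lemma admissible_0: "admissible 0 0"
  unfolding admissible_def level_0 using good_0[of R 0 0] R100 by (intro exI[of _ 0]) auto

text \<open>An ordinary stage only branches and keeps \<open>e\<close>. A descent first moves next
  to a rational, sets \<open>e\<close> to the level \<open>j\<close> reached there, and branches
  inside the new interval.\<close>

lemma admissible_children:
  assumes "admissible n a"
  shows "\<exists>g. (\<forall>d<m. admissible (Suc n) (g d) \<and> a \<le> g d \<and> g d + len (Suc n) \<le> a + len n \<and> near_rational n (g d)) \<and>
    (\<forall>d<m. \<forall>d'<m. d \<noteq> d' \<longrightarrow> 2 * len (Suc n) \<le> \<bar>g d - g d'\<bar>)"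
proof -
  obtain e where e: "good R (level n) e a" "\<And>i. i \<ge> 1 \<Longrightarrow> n \<le> M * 8 ^ i \<Longrightarrow> 2 * e \<le> level (M * 8 ^ i)"
    using assms unfolding admissible_def by blast
  show ?thesis
  proof (cases "\<exists>i\<ge>1. n = M * 8 ^ i")
    case False
    then have ls: "level (Suc n) = Suc (level n)" by (intro level_Suc) auto
    obtain g where g: "\<forall>d<m. good R (level (Suc n)) e (g d) \<and> a \<le> g d \<and> g d + len (Suc n) \<le> a + len n"
      "\<forall>d<m. \<forall>d'<m. d \<noteq> d' \<longrightarrow> 2 * len (Suc n) \<le> \<bar>g d - g d'\<bar>"
      using good_children[OF R_def e(1)] unfolding len_def ls by blast
    have "admissible (Suc n) (g d)" if "d < m" for d
      unfolding admissible_def using g(1) that e(2) by (intro exI[of _ e]) auto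
    moreover have "near_rational n y" for y using False unfolding near_rational_def by blast
    ultimately show ?thesis using g by blast
  next
    case True
    then obtain i where i: "i \<ge> 1" "n = M * 8 ^ i" by blast
    define j where "j = level n + 8 ^ i"
    have i_unique: "i' = i" if "n = M * 8 ^ i'" for i' using that i M by simp
    \<comment> \<open>Descents start at \<open>i = 1\<close> so that they skip at least the 6 levels
      that \<open>good_near_rational\<close> asks for.\<close>
    have "(8::nat) ^ 1 \<le> 8 ^ i" using i by (intro power_increasing) auto
    then have j: "j \<ge> level n + 6" by (simp add: j_def)
    obtain p :: int and q :: nat where pq: "q > 0" "real q \<le> 9 * R * sqrt (R ^ level n)"
      and gj: "good R j j (p / q + 1 / R ^ j)"
      and inside: "a \<le> p / q" "p / q + 2 / R ^ j \<le> a + 1 / R ^ level n"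
    proof (rule good_near_rational[OF R100 e(1) _ j])
      show "2 * e \<le> level n" using e(2)[OF i(1)] i(2) by simp
    qed
    define a' where "a' = p / q + 1 / R ^ j"
    have ls: "level (Suc n) = Suc j" using level_Suc_skip[OF i(1)] i(2) by (simp add: j_def)
    obtain g where g: "\<forall>d<m. good R (level (Suc n)) j (g d) \<and> a' \<le> g d \<and> g d + len (Suc n) \<le> a' + 1 / R ^ j"
      "\<forall>d<m. \<forall>d'<m. d \<noteq> d' \<longrightarrow> 2 * len (Suc n) \<le> \<bar>g d - g d'\<bar>"
      using good_children[OF R_def gj] unfolding len_def ls a'_def by blast
    have Rj: "1 / R ^ j > 0" using R100 by simp
    have two: "2 / R ^ j = 1 / R ^ j + 1 / R ^ j" by simp
    have adm: "admissible (Suc n) (g d)" if "d < m" for d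
      unfolding admissible_def
    proof (intro exI[of _ j] conjI allI impI)
      show "good R (level (Suc n)) j (g d)" using g(1) that by blast
      fix i' assume i': "1 \<le> i'" "Suc n \<le> M * 8 ^ i'"
      have "i < i'"
      proof (rule ccontr)
        assume "\<not> i < i'"
        then have "(8::nat) ^ i' \<le> 8 ^ i" by (intro power_increasing) auto
        then have "M * 8 ^ i' \<le> n" using i(2) by simp
        then show False using i'(2) by linarith
      qed
      then have "(8::nat) ^ Suc i \<le> 8 ^ i'" by (intro power_increasing) auto
      then have le: "M * (8 * 8 ^ i) \<le> M * 8 ^ i'" using mult_le_mono2 by (metis power_Suc)
      \<comment> \<open>The ratio 8 between descents is used here:
        \<open>2 * M + 6 \<le> 8 * M\<close> because \<open>M \<ge> 1\<close>, so the next descent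
        comes late enough.\<close>
      have "2 * j \<le> 2 * ((M + 3) * 8 ^ i)"
        using level_skip_le[of i] i(2) by (simp add: j_def algebra_simps)
      also have "\<dots> = (2 * M + 6) * 8 ^ i" by (simp add: algebra_simps)
      also have "\<dots> \<le> (8 * M) * 8 ^ i" using M by (intro mult_le_mono1) linarith
      also have "\<dots> = M * (8 * 8 ^ i)" by simp
      also have "\<dots> \<le> M * 8 ^ i'" by (rule le)
      also have "\<dots> \<le> level (M * 8 ^ i')" by (rule level_ge)
      finally show "2 * j \<le> level (M * 8 ^ i')" .
    qed
    have near: "near_rational n (g d)" if "d < m" for d
      unfolding near_rational_def
    proof (intro allI impI)
      fix i' assume "n = M * 8 ^ i'"
      then have ii: "level n + 8 ^ i' = j" using i_unique by (simp add: j_def)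
      have "p / q + 1 / R ^ j \<le> g d" "g d + len (Suc n) \<le> p / q + 2 / R ^ j"
      proof -
        have "a' \<le> g d" "g d + len (Suc n) \<le> a' + 1 / R ^ j" using g(1) that by auto
        then show "p / q + 1 / R ^ j \<le> g d" "g d + len (Suc n) \<le> p / q + 2 / R ^ j"
          using two unfolding a'_def by linarith+
      qed
      then show "\<exists>(p::int) (q::nat). q > 0 \<and> real q \<le> 9 * R * sqrt (R ^ level n) \<and>
        p / q + 1 / R ^ (level n + 8 ^ i') \<le> g d \<and> g d + len (Suc n) \<le> p / q + 2 / R ^ (level n + 8 ^ i')"
        using pq unfolding ii by blast
    qed
    have "a \<le> g d \<and> g d + len (Suc n) \<le> a + len n" if "d < m" for d
    proof -
      have "a' \<le> g d" "g d + len (Suc n) \<le> a' + 1 / R ^ j" using g(1) that by auto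
      then show ?thesis using inside two Rj unfolding a'_def len_def by linarith
    qed
    then show ?thesis using adm near g(2) by blast
  qed
qed

definition child :: "nat \<Rightarrow> real \<Rightarrow> nat \<Rightarrow> real" where
  "child n a = (SOME g. (\<forall>d<m. admissible (Suc n) (g d) \<and> a \<le> g d \<and> g d + len (Suc n) \<le> a + len n \<and> near_rational n (g d)) \<and>
    (\<forall>d<m. \<forall>d'<m. d \<noteq> d' \<longrightarrow> 2 * len (Suc n) \<le> \<bar>g d - g d'\<bar>))"

lemma child:
  assumes "admissible n a"
  shows "d < m \<Longrightarrow> admissible (Suc n) (child n a d) \<and> a \<le> child n a d \<and>
      child n a d + len (Suc n) \<le> a + len n \<and> near_rational n (child n a d)"
    and "d < m \<Longrightarrow> d' < m \<Longrightarrow> d \<noteq> d' \<Longrightarrow> 2 * len (Suc n) \<le> \<bar>child n a d - child n a d'\<bar>"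
proof -
  note c = someI_ex[OF admissible_children[OF assms], folded child_def]
  show "d < m \<Longrightarrow> admissible (Suc n) (child n a d) \<and> a \<le> child n a d \<and>
      child n a d + len (Suc n) \<le> a + len n \<and> near_rational n (child n a d)"
    using conjunct1[OF c] by simp
  show "d < m \<Longrightarrow> d' < m \<Longrightarrow> d \<noteq> d' \<Longrightarrow> 2 * len (Suc n) \<le> \<bar>child n a d - child n a d'\<bar>"
    using conjunct2[OF c] by simp
qed

text \<open>The path to a node is read off from the base-\<open>m\<close> digits of
  \<open>N\<close>, the least significant digit being the latest choice.\<close>

primrec node :: "nat \<Rightarrow> nat \<Rightarrow> real" where
  "node 0 N = 0"
| "node (Suc n) N = child n (node n (N div m)) (N mod m)"

lemma admissible_node: "admissible n (node n N)"
proof (induction n arbitrary: N)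
  case 0
  then show ?case by (simp add: admissible_0)
next
  case (Suc n)
  have "N mod m < m" using m by simp
  then show ?case using child(1)[OF Suc] by simp
qed

section \<open>Points of the Cantor set and the Hoelder estimate\<close>

text \<open>The integer whose base-m digits are the first n digits of t after the radix point.\<close>
definition digits :: "nat \<Rightarrow> real \<Rightarrow> nat" where
  "digits n t = nat \<lfloor>real m ^ n * t\<rfloor>"

lemma digits_Suc_div: "digits (Suc n) t div m = digits n t"
proof -
  have "\<lfloor>real m ^ Suc n * t\<rfloor> div int m = \<lfloor>real m ^ Suc n * t / real m\<rfloor>"
    by (metis floor_divide_real_eq_div of_int_of_nat_eq of_nat_0_le_iff)
  also have "real m ^ Suc n * t / real m = real m ^ n * t" using m by simp
  finally show ?thesis unfolding digits_def by (metis nat_div_distrib' nat_int of_nat_0_le_iff)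
qed

definition left :: "nat \<Rightarrow> real \<Rightarrow> real" where "left n t = node n (digits n t)"

lemma left_Suc: "left (Suc n) t = child n (left n t) (digits (Suc n) t mod m)"
  by (simp add: left_def digits_Suc_div)

lemma admissible_left: "admissible n (left n t)"
  by (simp add: left_def admissible_node)

lemma left_step:
  "left n t \<le> left (Suc n) t" "left (Suc n) t + len (Suc n) \<le> left n t + len n"
  "near_rational n (left (Suc n) t)"
proof -
  have "digits (Suc n) t mod m < m" using m by simp
  note c = child(1)[OF admissible_left[of n t] this, folded left_Suc]
  show "left n t \<le> left (Suc n) t" using c by simp
  show "left (Suc n) t + len (Suc n) \<le> left n t + len n" using c by simp
  show "near_rational n (left (Suc n) t)" using c by simp
qed

definition point :: "real \<Rightarrow> real" where "point t = (SUP n. left n t)"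

lemma point_bounds: "left n t \<le> point t" "point t \<le> left n t + len n"
proof -
  have inc: "incseq (\<lambda>n. left n t)" unfolding incseq_Suc_iff using left_step(1) by simp
  have dec: "decseq (\<lambda>n. left n t + len n)" unfolding decseq_Suc_iff using left_step(2) by simp
  have le: "left k t \<le> left n t + len n" for k n
  proof -
    have "left k t \<le> left (max k n) t" using incseqD[OF inc, of k "max k n"] by simp
    also have "\<dots> \<le> left (max k n) t + len (max k n)" using len_pos[of "max k n"] by simp
    also have "\<dots> \<le> left n t + len n" using decseqD[OF dec, of n "max k n"] by simp
    finally show ?thesis .
  qed
  have "bdd_above (range (\<lambda>n. left n t))"
    by (rule bdd_aboveI2[where M = "left 0 t + len 0"]) (rule le)
  then show "left n t \<le> point t" unfolding point_def by (intro cSUP_upper) auto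
  show "point t \<le> left n t + len n" unfolding point_def using le by (intro cSUP_least) auto
qed

text \<open>Let \<open>Suc k\<close> be the first place where the expansions differ. Agreement up to
  \<open>k\<close> bounds the difference of the parameters. The left ends at stage
  \<open>Suc k\<close> are two lengths apart, and since each point lies within one length to the
  right of its left end, one length remains.\<close>

lemma point_separation:
  assumes tu: "t \<in> {0..<1}" "u \<in> {0..<1}" "t \<noteq> u"
  shows "\<exists>k. \<bar>t - u\<bar> < 1 / real m ^ k \<and> len (Suc k) \<le> \<bar>point t - point u\<bar>"
proof -
  have near: "\<bar>t - u\<bar> < 1 / real m ^ k" if "digits k t = digits k u" for k
  proof -
    have "0 \<le> real m ^ k * t" "0 \<le> real m ^ k * u" using tu by auto
    then have "\<lfloor>real m ^ k * t\<rfloor> = \<lfloor>real m ^ k * u\<rfloor>"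
      using that unfolding digits_def by (metis floor_less_zero int_nat_eq not_less)
    then have "\<bar>real m ^ k * t - real m ^ k * u\<bar> < 1" by linarith
    then have "real m ^ k * \<bar>t - u\<bar> < 1" by (simp add: right_diff_distrib[symmetric] abs_mult)
    then show ?thesis using m by (simp add: field_simps)
  qed
  have "(\<lambda>k. (1 / real m) ^ k) \<longlonglongrightarrow> 0" using m by (intro LIMSEQ_power_zero) auto
  then have "eventually (\<lambda>k. (1 / real m) ^ k < \<bar>t - u\<bar>) sequentially"
    using tu(3) by (intro order_tendstoD(2)[where y = 0]) auto
  then obtain k0 where "1 / real m ^ k0 < \<bar>t - u\<bar>"
    by (auto simp: eventually_sequentially power_one_over)
  then have "digits k0 t \<noteq> digits k0 u" using near[of k0] by linarith
  then have ex: "\<exists>k. digits k t \<noteq> digits k u" by blast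
  define k1 where "k1 = (LEAST k. digits k t \<noteq> digits k u)"
  have k1: "digits k1 t \<noteq> digits k1 u" unfolding k1_def using ex by (rule LeastI_ex)
  have "\<lfloor>t\<rfloor> = 0" "\<lfloor>u\<rfloor> = 0" using tu by (auto simp: floor_eq_iff)
  then have "digits 0 t = digits 0 u" by (simp add: digits_def)
  with k1 obtain k where k: "k1 = Suc k" by (metis not0_implies_Suc)
  have eq: "digits k t = digits k u" using not_less_Least[of k "\<lambda>k. digits k t \<noteq> digits k u"] k by (auto simp: k1_def)
  have "digits (Suc k) t mod m \<noteq> digits (Suc k) u mod m"
    using k1 eq unfolding k by (metis digits_Suc_div div_mult_mod_eq)
  moreover have "left k t = left k u" by (simp add: left_def eq)
  ultimately have "2 * len (Suc k) \<le> \<bar>left (Suc k) t - left (Suc k) u\<bar>"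
    using child(2)[OF admissible_left[of k u], of "digits (Suc k) t mod m" "digits (Suc k) u mod m"] m
    by (simp add: left_Suc)
  then have "len (Suc k) \<le> \<bar>point t - point u\<bar>"
    using point_bounds[where n = "Suc k" and t = t] point_bounds[where n = "Suc k" and t = u] by linarith
  with near[OF eq] show ?thesis by blast
qed

text \<open>Since \<open>level (Suc k)\<close> is at most \<open>(1 + 2 / M) * Suc k\<close>, the
  hypothesis on \<open>s\<close> gives \<open>1 / m ^ Suc k \<le> len (Suc k) powr s\<close>. The
  constant \<open>m\<close> pays for the shift from \<open>k\<close> to
  \<open>Suc k\<close>.\<close>

lemma point_holder:
  assumes s: "s \<ge> 0" "R powr ((1 + 2 / M) * s) \<le> m"
    and tu: "t \<in> {0..<1}" "u \<in> {0..<1}" "t \<noteq> u"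
  shows "point t \<noteq> point u" "\<bar>t - u\<bar> \<le> m * \<bar>point t - point u\<bar> powr s"
proof -
  obtain k where k: "\<bar>t - u\<bar> < 1 / real m ^ k" "len (Suc k) \<le> \<bar>point t - point u\<bar>"
    using point_separation[OF tu] by blast
  show "point t \<noteq> point u" using k(2) len_pos[of "Suc k"] by auto
  have "real M * level (Suc k) \<le> (M + 2) * Suc k"
    using level_le[of "Suc k"] by (metis of_nat_le_iff of_nat_mult)
  then have lev: "real (level (Suc k)) \<le> (1 + 2 / M) * Suc k"
    using M by (simp add: field_simps)
  have "real m ^ Suc k \<ge> (R powr ((1 + 2 / M) * s)) ^ Suc k"
    using s(2) by (intro power_mono) auto
  also have "(R powr ((1 + 2 / M) * s)) ^ Suc k = R powr ((1 + 2 / M) * Suc k * s)"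
    using R100 by (simp only: powr_power) (simp add: algebra_simps)
  finally have "R powr ((1 + 2 / M) * Suc k * s) \<le> real m ^ Suc k" .
  moreover have "R powr (level (Suc k) * s) \<le> R powr ((1 + 2 / M) * Suc k * s)"
    using R100 lev s(1) by (intro powr_mono mult_right_mono) auto
  ultimately have "R powr (level (Suc k) * s) \<le> real m ^ Suc k" by linarith
  then have "1 / real m ^ Suc k \<le> 1 / R powr (level (Suc k) * s)"
    using R100 m by (intro divide_left_mono) auto
  also have "\<dots> = len (Suc k) powr s"
    using R100 by (simp add: len_def powr_divide powr_powr flip: powr_realpow)
  also have "\<dots> \<le> \<bar>point t - point u\<bar> powr s"
    using k(2) s(1) len_pos[of "Suc k"] by (intro powr_mono2) auto
  finally have "m * (1 / real m ^ Suc k) \<le> m * \<bar>point t - point u\<bar> powr s"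
    by (intro mult_left_mono) auto
  moreover have "m * (1 / real m ^ Suc k) = 1 / real m ^ k" using m by simp
  ultimately show "\<bar>t - u\<bar> \<le> m * \<bar>point t - point u\<bar> powr s" using k(1) by linarith
qed

section \<open>Diophantine properties of the points\<close>

text \<open>Every denominator is eventually controlled by the goodness of some stage. On the right
  the margin is independent of the stage; on the left it depends on \<open>e\<close>, and only its
  positivity is used.\<close>

lemma point_away_from_rational:
  fixes p :: int and q :: nat
  assumes "q > 0"
  shows "1 / (8 * R\<^sup>2 * (real q)\<^sup>2) \<le> p / q - point t \<or> p / q < point t"
proof -
  obtain n where "4 * R * (real q)\<^sup>2 < R ^ n" using real_arch_pow[of R] R100 by auto
  also have "R ^ n \<le> R ^ level n" using R100 level_ge by (intro power_increasing) auto
  finally have n': "4 * R * (real q)\<^sup>2 < R ^ level n" .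
  obtain e where "good R (level n) e (left n t)" using admissible_left unfolding admissible_def by blast
  moreover define z w where "z = 1 / (8 * R\<^sup>2 * (real q)\<^sup>2)" and "w = min z (1 / R ^ e)"
  ultimately have "left n t + len n + z \<le> p / q \<or> p / q + w \<le> left n t"
    using n' assms unfolding good_def len_def by blast
  moreover have "w > 0" using R100 assms by (simp add: w_def z_def)
  ultimately have "z \<le> p / q - point t \<or> p / q < point t"
    using point_bounds[where n = n and t = t] by linarith
  then show ?thesis by (simp add: z_def)
qed

lemma point_irrational: "point t \<notin> \<rat>"
proof
  assume "point t \<in> \<rat>"
  then obtain p q :: int where q: "q > 0" and pt: "point t = p / q"
    by (rule Rats_cases') auto
  define n where "n = nat q"
  have n: "n > 0" and nq: "real n = q" using q by (auto simp: n_def)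
  have "1 / (8 * R\<^sup>2 * (real n)\<^sup>2) > 0" using R100 n by simp
  moreover have "p / n = point t" by (simp add: nq pt)
  ultimately show False using point_away_from_rational[OF n, of p t] by linarith
qed

text \<open>The descent at stage \<open>M * 8 ^ i\<close> gives an error of at most
  \<open>2 / R ^ j\<close> with \<open>q\<close> at most \<open>R powr (2 + k / 2)\<close>. As
  \<open>k \<le> (M + 2) * 8 ^ i\<close>, the gain \<open>j - k = 8 ^ i\<close> outweighs the excess
  of \<open>\<alpha>\<close> over 2.\<close>

lemma point_approx:
  assumes \<alpha>: "0 \<le> \<alpha>" "\<alpha> \<le> 2 + 1 / (real M + 2)" and i: "i \<ge> 2"
  shows "\<exists>(p::int) (q::nat). q > 0 \<and> \<bar>point t - p / q\<bar> \<le> 2 / R ^ i \<and> \<bar>point t - p / q\<bar> < real q powr (- \<alpha>)"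
proof -
  define k where "k = level (M * 8 ^ i)"
  define j where "j = k + 8 ^ i"
  obtain p :: int and q :: nat where q: "q > 0" "real q \<le> 9 * R * sqrt (R ^ k)"
    and y: "p / q + 1 / R ^ j \<le> left (Suc (M * 8 ^ i)) t"
      "left (Suc (M * 8 ^ i)) t + len (Suc (M * 8 ^ i)) \<le> p / q + 2 / R ^ j"
    using left_step(3)[of "M * 8 ^ i" t, unfolded near_rational_def, rule_format, of i] i
    unfolding k_def[symmetric] j_def[symmetric] by auto
  have "1 / R ^ j > 0" using R100 by simp
  then have ap: "\<bar>point t - p / q\<bar> \<le> 2 / R ^ j"
    using y point_bounds[where n = "Suc (M * 8 ^ i)" and t = t] by linarith
  have "i < 8 ^ i" by (induction i) auto
  then have "R ^ i \<le> R ^ j" using R100 by (intro power_increasing) (auto simp: j_def)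
  then have "2 / R ^ j \<le> 2 / R ^ i" using R100 by (intro divide_left_mono) auto
  have R0: "R > 0" "R \<ge> 1" using R100 by auto
  have "9 * R \<le> R * R" using R100 by (intro mult_right_mono) auto
  then have "9 * R \<le> R powr 2" using R0 by (simp add: power2_eq_square)
  moreover have "sqrt (R ^ k) = R powr (k / 2)"
  proof -
    have "sqrt (R ^ k) = (R powr real k) powr (1 / 2)"
      using R0 by (simp only: powr_realpow powr_half_sqrt zero_le_power less_imp_le)
    then show ?thesis by (simp add: powr_powr)
  qed
  ultimately have "9 * R * sqrt (R ^ k) \<le> R powr 2 * R powr (k / 2)" by (simp add: mult_right_mono)
  then have "real q \<le> R powr (2 + k / 2)" using q(2) by (simp add: powr_add)
  then have "real q powr \<alpha> \<le> (R powr (2 + k / 2)) powr \<alpha>" using \<alpha> by (intro powr_mono2) auto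
  also have "\<dots> = R powr ((2 + k / 2) * \<alpha>)" by (simp add: powr_powr)
  also have "\<dots> < R powr (real j - 1)"
  proof -
    have "real k \<le> (M + 2) * 8 ^ i"
      using level_skip_le[of i] unfolding k_def by (metis of_nat_le_iff of_nat_mult of_nat_numeral of_nat_power)
    then have k1: "real k / (real M + 2) \<le> 8 ^ i" by (simp add: field_simps)
    have "(8::real) ^ 2 \<le> 8 ^ i" using i by (intro power_increasing) auto
    then have e: "(8::real) ^ i \<ge> 64" by simp
    define r where "r = 1 / (real M + 2)"
    have r: "r \<le> 1" "real k * r \<le> 8 ^ i" using k1 by (simp_all add: r_def)
    \<comment> \<open>The excess costs only half of \<open>8 ^ i\<close>. The other half is at least
      32 because \<open>i \<ge> 2\<close>, which absorbs the constants and a spare factor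
      \<open>R\<close>.\<close>
    have "(2 + k / 2) * \<alpha> \<le> (2 + k / 2) * (2 + r)" using \<alpha> by (intro mult_left_mono) (auto simp: r_def)
    also have "\<dots> = 4 + k + 2 * r + real k * r / 2" by (simp add: algebra_simps)
    also have "\<dots> \<le> 6 + k + 8 ^ i / 2" using r by linarith
    also have "\<dots> < real j - 1" using e by (simp add: j_def)
    finally show ?thesis using R100 by (intro powr_less_mono) auto
  qed
  also have "\<dots> = R ^ j / R"
    unfolding powr_diff using R0 by (simp add: powr_realpow)
  also have "\<dots> \<le> R ^ j / 2" using R100 by (intro divide_left_mono) auto
  finally have "real q powr \<alpha> < R ^ j / 2" .
  moreover have "real q powr \<alpha> > 0" using q by simp
  ultimately have "2 / R ^ j < 1 / real q powr \<alpha>" using R0 by (simp add: field_simps)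
  then have "2 / R ^ j < real q powr (- \<alpha>)" by (simp add: powr_minus divide_inverse)
  then have "\<bar>point t - p / q\<bar> < real q powr (- \<alpha>)" using ap by linarith
  then show ?thesis using q(1) ap \<open>2 / R ^ j \<le> 2 / R ^ i\<close> by (meson order_trans)
qed

lemma point_irrationality_exponent:
  assumes \<alpha>: "0 \<le> \<alpha>" "\<alpha> \<le> 2 + 1 / (real M + 2)"
  shows "ereal \<alpha> \<le> irrationality_exponent (point t)"
proof (rule irrationality_exponent_ge[OF point_irrational \<alpha>(1)])
  fix \<delta> :: real assume \<delta>: "\<delta> > 0"
  have "(\<lambda>i. 2 * (1 / R) ^ i) \<longlonglongrightarrow> 2 * 0" using R100 by (intro tendsto_mult_left LIMSEQ_power_zero) auto
  then have "eventually (\<lambda>i. 2 * (1 / R) ^ i < \<delta>) sequentially"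
    using \<delta> by (intro order_tendstoD(2)) auto
  then obtain N where N: "\<And>i. i \<ge> N \<Longrightarrow> 2 * (1 / R) ^ i < \<delta>" by (auto simp: eventually_sequentially)
  define i where "i = max 2 N"
  have "2 / R ^ i < \<delta>" using N[of i] by (simp add: i_def power_one_over)
  moreover have "i \<ge> 2" by (simp add: i_def)
  ultimately show "\<exists>(p::int) (q::nat). q > 0 \<and> \<bar>point t - p / q\<bar> < \<delta> \<and> \<bar>point t - p / q\<bar> < real q powr (- \<alpha>)"
    using point_approx[OF \<alpha>, of i t] order_le_less_trans[of _ "2 / R ^ i" \<delta>] by blast
qed

end

section \<open>The dimension bound and the limit at 2\<close>

lemma (in cantor_tree) hausdorff_dim_ge_cantor:
  assumes s: "s \<ge> 0" "R powr ((1 + 2 / M) * s) \<le> m"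
    and \<alpha>: "0 \<le> \<alpha>" "\<alpha> \<le> 2 + 1 / (real M + 2)"
  shows "s \<le> hausdorff_dim (G \<alpha> \<inter> {x. x \<notin> \<rat> \<and> (\<exists>M. \<forall>n\<ge>1. \<bar>bcf_digit n x\<bar> \<le> M)})"
    (is "s \<le> hausdorff_dim ?A")
proof (rule hausdorff_dim_ge)
  fix s' :: real assume s': "0 \<le> s'" "s' < s"
  have "R powr ((1 + 2 / M) * s') \<le> R powr ((1 + 2 / M) * s)"
    using s' R100 by (intro powr_mono mult_left_mono) auto
  then have s'_le: "R powr ((1 + 2 / M) * s') \<le> m" using s(2) by linarith
  have "point t \<in> ?A" for t
  proof -
    have "\<exists>M. \<forall>n\<ge>1. \<bar>bcf_digit n (point t)\<bar> \<le> M"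
    proof (rule bcf_digits_bounded[OF point_irrational, of "1 / (8 * R\<^sup>2)"])
      show "1 / (8 * R\<^sup>2) > 0" using R100 by simp
      fix p :: int and q :: nat
      assume "q > 0" "point t < p / q"
      then show "1 / (8 * R\<^sup>2) / (real q)\<^sup>2 \<le> p / q - point t"
        using point_away_from_rational[of q p t] by simp
    qed
    then show ?thesis
      using point_irrational point_irrationality_exponent[OF \<alpha>] by (simp add: G_def)
  qed
  then show "hausdorff_measure s' ?A \<noteq> 0"
    using m point_holder[OF s'(1) s'_le]
    by (intro hausdorff_measure_neq_0[where C = "real m" and f = point] s'(1)) auto
qed

text \<open>With \<open>r\<close> halfway between \<open>s\<close> and 1, \<open>M\<close> is chosen
  to make \<open>(1 + 2 / M) * s \<le> r\<close>, and \<open>m\<close> to make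
  \<open>(4 * m) powr r \<le> m\<close>, that is,
  \<open>4 powr r \<le> m powr (1 - r)\<close>.\<close>

lemma exists_cantor_parameters:
  fixes s :: real
  assumes "0 < s" "s < 1"
  shows "\<exists>m M :: nat. m \<ge> 49 \<and> M \<ge> 1 \<and> (2 * real m + 2) powr ((1 + 2 / real M) * s) \<le> real m"
proof -
  define r where "r = (1 + s) / 2"
  have r: "s < r" "r < 1" "0 < r" using assms by (auto simp: r_def)
  define M where "M = nat \<lceil>2 * s / (r - s)\<rceil>"
  have pos: "2 * s / (r - s) > 0" using assms r by simp
  have M: "real M \<ge> 2 * s / (r - s)" "M \<ge> 1"
    using pos by (auto simp: M_def intro: real_nat_ceiling_ge) linarith
  have "2 * s \<le> real M * (r - s)" using M(1) r by (simp add: field_simps)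
  then have Ms: "(1 + 2 / real M) * s \<le> r" using M(2) by (simp add: field_simps)
  define m where "m = max 49 (nat \<lceil>4 powr (r / (1 - r))\<rceil>)"
  have m: "m \<ge> 49" and "real m \<ge> 4 powr (r / (1 - r))"
    unfolding m_def by linarith+
  then have "(4 powr (r / (1 - r))) powr (1 - r) \<le> real m powr (1 - r)"
    using r by (intro powr_mono2) auto
  then have 4: "4 powr r \<le> real m powr (1 - r)" using r by (simp add: powr_powr)
  have "(2 * real m + 2) powr ((1 + 2 / real M) * s) \<le> (2 * real m + 2) powr r"
    using Ms by (intro powr_mono) auto
  also have "\<dots> \<le> (4 * real m) powr r" using m r by (intro powr_mono2) auto
  also have "\<dots> = 4 powr r * real m powr r" by (simp add: powr_mult)
  also have "\<dots> \<le> real m powr (1 - r) * real m powr r" using 4 by (intro mult_right_mono) auto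
  also have "\<dots> = real m" using m by (simp flip: powr_add)
  finally show ?thesis using m M(2) by blast
qed

theorem theorem2:
  shows "((\<lambda>\<alpha>. hausdorff_dim (G \<alpha> \<inter>
            {x. x \<notin> \<rat> \<and> (\<exists>M. \<forall>n\<ge>1. \<bar>bcf_digit n x\<bar> \<le> M)}))
          \<longlongrightarrow> 1) (at_right 2)"
proof (rule order_tendstoI)
  fix a :: real assume "a < 1"
  \<comment> \<open>Any exponent strictly between \<open>max a 0\<close> and 1 would do; its
    parameter \<open>M\<close> fixes the right neighbourhood of 2 on which the bound holds.\<close>
  define s where "s = (max a 0 + 1) / 2"
  have s: "0 < s" "s < 1" "a < s" using \<open>a < 1\<close> by (auto simp: s_def max_def)
  obtain m M :: nat where mM: "m \<ge> 49" "M \<ge> 1" "(2 * real m + 2) powr ((1 + 2 / real M) * s) \<le> real m"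
    using exists_cantor_parameters[OF s(1,2)] by blast
  interpret cantor_tree m M using mM by unfold_locales
  have "0 < real M + 2" by linarith
  then have pos: "0 < 1 / (real M + 2)" by (rule divide_pos_pos[OF zero_less_one])
  have "a < hausdorff_dim (G \<alpha> \<inter> {x. x \<notin> \<rat> \<and> (\<exists>M. \<forall>n\<ge>1. \<bar>bcf_digit n x\<bar> \<le> M)})"
    if "\<alpha> \<in> {2<..<2 + 1 / (real M + 2)}" for \<alpha>
  proof -
    have "0 \<le> \<alpha>" "\<alpha> \<le> 2 + 1 / (real M + 2)" using that by auto
    then show ?thesis
      using hausdorff_dim_ge_cantor[of s \<alpha>] mM(3) s by (simp add: R_def)
  qed
  then show "eventually (\<lambda>\<alpha>. a < hausdorff_dim (G \<alpha> \<inter>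
      {x. x \<notin> \<rat> \<and> (\<exists>M. \<forall>n\<ge>1. \<bar>bcf_digit n x\<bar> \<le> M)})) (at_right 2)"
    using pos by (intro eventually_at_rightI[of 2 "2 + 1 / (real M + 2)"]) auto
next
  fix a :: real assume "1 < a"
  then show "eventually (\<lambda>\<alpha>. hausdorff_dim (G \<alpha> \<inter>
      {x. x \<notin> \<rat> \<and> (\<exists>M. \<forall>n\<ge>1. \<bar>bcf_digit n x\<bar> \<le> M)}) < a) (at_right 2)"
    using hausdorff_dim_le_1 by (intro always_eventually allI) (rule order_le_less_trans)
qed

end
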